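(* Let $\xi=(\tau_L,\delta_L,\tau_R,\delta_R)\in\Phi_{\rm BYG}$ and suppose $J_1(\xi)>1$ and $J_2(\xi)<1$. Then $f_\xi$ is chaotic in the sense of Devaney on $\Lambda$: $f_\xi$ restricted to $\Lambda$ is topologically transitive, its periodic points are dense in $\Lambda$, and it has sensitive dependence on initial conditions on $\Lambda$.
   Context: For $\xi=(\tau_L,\delta_L,\tau_R,\delta_R)\in\mathbb{R}^4$ define the continuous piecewise-linear map $f_\xi:\mathbb{R}^2\to\mathbb{R}^2$ by $f_\xi(x,y)=(\tau_L x+y+1,\,-\delta_L x)$ if $x\le 0$ and $f_\xi(x,y)=(\tau_R x+y+1,\,-\delta_R x)$ if $x\ge 0$. Let $A_L=\begin{bmatrix}\tau_L&1\\-\delta_L&0\end{bmatrix}$ and $A_R=\begin{bmatrix}\tau_R&1\\-\delta_R&0\end{bmatrix}$. Let $\Phi=\{\xi\in\mathbb{R}^4: \tau_L>\delta_L+1,\ \delta_L>0,\ \tau_R<-(\delta_R+1),\ \delta_R>0\}$. For $\xi\in\Phi$ the eigenvalues of $A_L$ are real with $0<\lambda_L^s<1<\lambda_L^u$, the eigenvalues of $A_R$ are real with $\lambda_R^u<-1<\lambda_R^s<0$, $f_\xi$ is a homeomorphism, and $X=\left(\frac{1}{\delta_R+1-\tau_R},\frac{-\delta_R}{\delta_R+1-\tau_R}\right)$ is a saddle fixed point of $f_\xi$. Let $\phi(\xi)=\delta_R-\left(\tau_R+\delta_L+\delta_R-(1+\tau_R)\lambda_L^u\right)\lambda_L^u$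 and $\Phi_{\rm BYG}=\{\xi\in\Phi:\phi(\xi)>0\}$. Let $J_1(\xi)=\frac{\lambda_L^u(\lambda_R^u)^2}{\lambda_L^u+|\lambda_R^u|}$ and $J_2(\xi)=\max\left\{\lambda_L^s,\frac{\sqrt2\,\lambda_L^s}{\lambda_L^s+1}\right\}+\max\left\{|\lambda_R^s|,\frac{\sqrt2\,|\lambda_R^s|}{|\lambda_R^s|+1}\right\}$. The unstable manifold of $X$ is $W^u(X)=\{P: f_\xi^{-n}(P)\to X\text{ as }n\to\infty\}$ and $\Lambda$ is its closure. *)

theory Defs
  imports "HOL-Analysis.Analysis"
begin

type_synonym param = "real \<times> real \<times> real \<times> real"

definition tauL :: "param \<Rightarrow> real" where "tauL xi = fst xi"
definition deltaL :: "param \<Rightarrow> real" where "deltaL xi = fst (snd xi)"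
definition tauR :: "param \<Rightarrow> real" where "tauR xi = fst (snd (snd xi))"
definition deltaR :: "param \<Rightarrow> real" where "deltaR xi = snd (snd (snd xi))"

definition bcnf :: "param \<Rightarrow> real \<times> real \<Rightarrow> real \<times> real" where
  "bcnf xi P = (let x = fst P; y = snd P in
     if x \<le> 0 then (tauL xi * x + y + 1, - deltaL xi * x)
     else (tauR xi * x + y + 1, - deltaR xi * x))"

definition Phi :: "param set" where
  "Phi = {xi. tauL xi > deltaL xi + 1 \<and> deltaL xi > 0 \<and>
              tauR xi < - (deltaR xi + 1) \<and> deltaR xi > 0}"

text \<open>Eigenvalues of A_L and A_R (roots of lambda^2 - tau lambda + delta), labelled as in the paper.\<close>
definition lamLs :: "param \<Rightarrow> real" where
  "lamLs xi = (tauL xi - sqrt ((tauL xi)\<^sup>2 - 4 * deltaL xi)) / 2"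
definition lamLu :: "param \<Rightarrow> real" where
  "lamLu xi = (tauL xi + sqrt ((tauL xi)\<^sup>2 - 4 * deltaL xi)) / 2"
definition lamRs :: "param \<Rightarrow> real" where
  "lamRs xi = (tauR xi + sqrt ((tauR xi)\<^sup>2 - 4 * deltaR xi)) / 2"
definition lamRu :: "param \<Rightarrow> real" where
  "lamRu xi = (tauR xi - sqrt ((tauR xi)\<^sup>2 - 4 * deltaR xi)) / 2"

definition phi :: "param \<Rightarrow> real" where
  "phi xi = deltaR xi - (tauR xi + deltaL xi + deltaR xi - (1 + tauR xi) * lamLu xi) * lamLu xi"

definition Phi_BYG :: "param set" where
  "Phi_BYG = {xi \<in> Phi. phi xi > 0}"

definition J1 :: "param \<Rightarrow> real" where
  "J1 xi = lamLu xi * (lamRu xi)\<^sup>2 / (lamLu xi + \<bar>lamRu xi\<bar>)"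

definition J2 :: "param \<Rightarrow> real" where
  "J2 xi = max (lamLs xi) (sqrt 2 * lamLs xi / (lamLs xi + 1))
         + max \<bar>lamRs xi\<bar> (sqrt 2 * \<bar>lamRs xi\<bar> / (\<bar>lamRs xi\<bar> + 1))"

definition fixX :: "param \<Rightarrow> real \<times> real" where
  "fixX xi = (1 / (deltaR xi + 1 - tauR xi), - deltaR xi / (deltaR xi + 1 - tauR xi))"

text \<open>Unstable manifold of X (f_xi is a homeomorphism on Phi, so inv is its inverse) and its closure.\<close>
definition Wu :: "param \<Rightarrow> (real \<times> real) set" where
  "Wu xi = {P. ((\<lambda>n. (inv (bcnf xi) ^^ n) P) \<longlongrightarrow> fixX xi) sequentially}"

definition Lambda :: "param \<Rightarrow> (real \<times> real) set" where
  "Lambda xi = closure (Wu xi)"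

definition top_transitive_on :: "('a::metric_space \<Rightarrow> 'a) \<Rightarrow> 'a set \<Rightarrow> bool" where
  "top_transitive_on f S \<longleftrightarrow>
     (\<forall>U V. openin (top_of_set S) U \<and> openin (top_of_set S) V \<and> U \<noteq> {} \<and> V \<noteq> {}
        \<longrightarrow> (\<exists>n>0. (f ^^ n) ` U \<inter> V \<noteq> {}))"

definition periodic_dense_on :: "('a::metric_space \<Rightarrow> 'a) \<Rightarrow> 'a set \<Rightarrow> bool" where
  "periodic_dense_on f S \<longleftrightarrow> S \<subseteq> closure {P \<in> S. \<exists>n>0. (f ^^ n) P = P}"

definition sensitive_on :: "('a::metric_space \<Rightarrow> 'a) \<Rightarrow> 'a set \<Rightarrow> bool" where
  "sensitive_on f S \<longleftrightarrow>
     (\<exists>\<delta>>0. \<forall>P\<in>S. \<forall>\<epsilon>>0. \<exists>Q\<in>S. \<exists>n. dist P Q < \<epsilon> \<and> dist ((f ^^ n) P) ((f ^^ n) Q) > \<delta>)"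

definition devaney_chaotic_on :: "('a::metric_space \<Rightarrow> 'a) \<Rightarrow> 'a set \<Rightarrow> bool" where
  "devaney_chaotic_on f S \<longleftrightarrow> top_transitive_on f S \<and> periodic_dense_on f S \<and> sensitive_on f S"

end

(*
  The slopes between the unstable eigendirections of the two pieces form an invariant cone on which
  horizontal lengths are stretched by a = lamLu on the left and by b = |lamRu| on the right. With
  r = |lamRs| and s = lamLs, the condition phi > 0 says that the triangle cut off by the invariant lines
  of the left saddle is trapping, and J2 < 1 is only needed through s + r < 1, which places the image of
  the switching line to the right of the local stable manifold of X. Hence a piece of a cut segment whose
  image reaches the switching line again has crossed that stable manifold, and otherwise J1 > 1, that is
  1 / (a b) + 1 / b^2 < 1, makes a piece outgrow the segment it came from. So every segment with slope in
  the cone has an iterate crossing the local stable manifold of X, after which it spreads along the whole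
  unstable manifold. This gives transitivity and sensitivity; the transverse homoclinic points, which are
  dense, are accumulated by periodic points heteroclinically connected to X.
*)
theory Submission
  imports Defs
begin

text \<open>The map is only piecewise affine, so smooth theorems about homoclinic points do not
  apply. Instead, each homoclinic point comes with an affine formula for an iterate on a full ball
  around it. Near \<open>X\<close> the map is diagonal in eigencoordinates while orbits stay right
  of the switching line, so the inclination lemma and the search for periodic points become linear
  algebra. The condition \<open>s + r < 1\<close> has two geometric effects: the triangle meets the
  switching line above the stable line of \<open>X\<close>, and a crossing of that line inside the
  triangle happens before the local stable segment ends. Finding periodic points near the unstable
  manifold is not enough: each must itself be a limit of the manifold, which is why its stable
  direction is constructed too.\<close>

text \<open>The parameters are those of the map written in terms of its eigenvalues \<^term>\<open>a\<close>, \<^term>\<open>s\<close> on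
  the left and \<^term>\<open>- b\<close>, \<^term>\<open>- r\<close> on the right.\<close>

locale bcn =
  fixes a s b r :: real
  assumes a1: "1 < a" and s0: "0 < s" and b1: "1 < b" and r0: "0 < r"
    and sr: "s + r < 1"
    and expansion: "a + b < a * b\<^sup>2"
    and trapping: "(a - 1) * (a * (b + r) + b * r) < a\<^sup>2 * (1 - s)"
begin

definition AL :: "real \<times> real \<Rightarrow> real \<times> real" where
  "AL D = ((a + s) * fst D + snd D, - (a * s) * fst D)"

definition AR :: "real \<times> real \<Rightarrow> real \<times> real" where
  "AR D = (- (b + r) * fst D + snd D, - (b * r) * fst D)"

definition f :: "real \<times> real \<Rightarrow> real \<times> real" where
  "f P = (if fst P \<le> 0 then AL P else AR P) + (1, 0)"

text \<open>Being the horizontal distance from \<open>X\<close> to the switching line, it is the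
  scale for all smallness conditions near \<open>X\<close>.\<close>

definition xX :: real where "xX = 1 / ((1 + b) * (1 + r))"

definition X :: "real \<times> real" where "X = (xX, - (b * r) * xX)"

text \<open>Coordinates along the eigenvectors of \<^term>\<open>AR\<close>: the first is stable, the second unstable.\<close>

definition E :: "real \<Rightarrow> real \<Rightarrow> real \<times> real" where
  "E c d = (c + d, b * c + r * d)"

definition cs :: "real \<times> real \<Rightarrow> real" where "cs v = (snd v - r * fst v) / (b - r)"

definition cu :: "real \<times> real \<Rightarrow> real" where "cu v = (b * fst v - snd v) / (b - r)"

text \<open>Two sides lie on the stable and unstable lines of the left fixed point; the third joins the
  first two iterates of the point where the unstable one meets the switching line.\<close>

definition trap :: "(real \<times> real) set" where
  "trap = {P. a * fst P + snd P + a / (a - 1) \<ge> 0 \<and> s * fst P + snd P \<le> s / (1 - s) \<and>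
              b * r * (fst P - 1 / (1 - s)) \<le> (b + r + s) * snd P}"

definition cone :: "(real \<times> real) set" where
  "cone = {D. fst D \<noteq> 0 \<and> (\<exists>m. - s \<le> m \<and> m \<le> r \<and> snd D = m * fst D)}"

section \<open>The map and its eigencoordinates at \<open>X\<close>\<close>

lemma r1: "r < 1" and s1: "s < 1" and br: "r < b"
  using s0 r0 sr b1 by auto

lemma xX_pos: "0 < xX"
  using b1 r0 by (simp add: xX_def)

lemma linear_AL: "linear AL"
  by (rule linearI) (auto simp: AL_def algebra_simps)

lemma linear_AR: "linear AR"
  by (rule linearI) (auto simp: AR_def algebra_simps)

lemma f_left: "fst P \<le> 0 \<Longrightarrow> f P = AL P + (1, 0)"
  by (simp add: f_def)

lemma f_right: "0 \<le> fst P \<Longrightarrow> f P = AR P + (1, 0)"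
  by (cases "fst P = 0") (auto simp: f_def AL_def AR_def)

text \<open>A formula without case split gives continuity, and shows that \<open>snd (f P)\<close>
  is a strictly decreasing function of \<open>fst P\<close> alone.\<close>

lemma f_min_max:
  "f P = ((a + s) * min (fst P) 0 - (b + r) * max (fst P) 0 + snd P + 1,
          - (a * s) * min (fst P) 0 - b * r * max (fst P) 0)"
  by (auto simp: f_def AL_def AR_def min_def max_def algebra_simps)

lemma continuous_f: "continuous_on UNIV f"
  unfolding f_min_max[abs_def] by (intro continuous_intros)

lemma continuous_funpow: "continuous_on UNIV (f ^^ n)"
proof (induction n)
  case (Suc n)
  then show ?case
    using continuous_on_compose[OF Suc, of f] continuous_f
    by (auto simp: intro: continuous_on_subset)
qed (simp add: id_def)

lemma bij_f: "bij f"
proof (rule bijI)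
  have as: "a * s > 0" "b * r > 0" using a1 s0 b1 r0 by auto
  show "inj f"
  proof (rule injI)
    fix P Q assume e: "f P = f Q"
    have "fst P = fst Q"
    proof -
      have e2: "snd (f P) = snd (f Q)" using e by simp
      consider "fst P \<le> 0" "fst Q \<le> 0" | "fst P > 0" "fst Q > 0"
        | "fst P \<le> 0" "fst Q > 0" | "fst P > 0" "fst Q \<le> 0" by linarith
      then show ?thesis
      proof cases
        case 3
        then have "a * s * fst P \<le> 0" "b * r * fst Q > 0"
          using as by (auto simp: mult_nonneg_nonpos)
        then show ?thesis using e2 3 by (simp add: f_def AL_def AR_def)
      next
        case 4
        then have "a * s * fst Q \<le> 0" "b * r * fst P > 0"
          using as by (auto simp: mult_nonneg_nonpos)
        then show ?thesis using e2 4 by (simp add: f_def AL_def AR_def)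
      qed (use e2 as in \<open>auto simp: f_def AL_def AR_def\<close>)
    qed
    then show "P = Q" using e by (auto simp: f_min_max prod_eq_iff)
  qed
  show "surj f"
  proof (rule surjI)
    fix Q :: "real \<times> real"
    let ?x = "if snd Q \<ge> 0 then - snd Q / (a * s) else - snd Q / (b * r)"
    let ?t = "if snd Q \<ge> 0 then a + s else - (b + r)"
    have "snd Q \<ge> 0 \<Longrightarrow> ?x \<le> 0" "snd Q < 0 \<Longrightarrow> ?x > 0"
      using as by (auto simp: field_simps)
    then show "f (?x, fst Q - 1 - ?t * ?x) = Q"
      using a1 s0 b1 r0 by (auto simp: f_def AL_def AR_def prod_eq_iff)
  qed
qed

lemma E_add: "E c d + E c' d' = E (c + c') (d + d')"
  by (simp add: E_def algebra_simps)

lemma E_scale: "k *\<^sub>R E c d = E (k * c) (k * d)"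
  by (simp add: E_def algebra_simps)

lemma E_cs_cu: "E (cs v) (cu v) = v"
proof -
  have "b - r \<noteq> 0" using br by simp
  then show ?thesis
    by (auto simp: E_def cs_def cu_def prod_eq_iff divide_simps) (auto simp: algebra_simps)
qed

lemma cs_E [simp]: "cs (E c d) = c" and cu_E [simp]: "cu (E c d) = d"
proof -
  have "b - r \<noteq> 0" using br by simp
  then show "cs (E c d) = c" "cu (E c d) = d"
    by (simp_all add: E_def cs_def cu_def field_simps)
qed

lemma linear_cu: "linear cu"
  by (rule linearI) (auto simp: cu_def algebra_simps diff_divide_distrib add_divide_distrib)

lemma norm_E_le: "norm (E c d) \<le> norm (E 1 0) * \<bar>c\<bar> + norm (E 0 1) * \<bar>d\<bar>"
proof -
  have "E c d = c *\<^sub>R E 1 0 + d *\<^sub>R E 0 1" by (simp add: E_scale E_add)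
  then show ?thesis by (metis norm_scaleR norm_triangle_ineq mult.commute)
qed

lemma AR_E: "AR (E c d) = E (- r * c) (- b * d)"
  by (simp add: AR_def E_def algebra_simps)

lemma xX_eq: "(1 + b) * (1 + r) * xX = 1"
  using b1 r0 by (simp add: xX_def)

lemma AR_X: "AR X + (1, 0) = X"
  using xX_eq by (simp add: AR_def X_def algebra_simps)

text \<open>\<open>- xX \<le> c + d\<close> says that the point lies on the right, where the
  displacement from \<open>X\<close> evolves by \<open>AR\<close>.\<close>

lemma f_near_X: 
  assumes "- xX \<le> c + d"
  shows "f (X + E c d) = X + E (- r * c) (- b * d)"
proof -
  have "f (X + E c d) = AR X + AR (E c d) + (1, 0)"
    using assms f_right[of "X + E c d"] by (simp add: linear_add[OF linear_AR]) (simp add: X_def E_def)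
  then show ?thesis using AR_X AR_E by (metis add.assoc add.commute)
qed

text \<open>The stable part only shrinks and the unstable part is largest at the last step, so one
  inequality keeps all earlier iterates on the right.\<close>

lemma funpow_near_X:
  assumes "\<bar>c\<bar> + b ^ k * \<bar>d\<bar> < xX"
  shows "(f ^^ k) (X + E c d) = X + E ((- r) ^ k * c) ((- b) ^ k * d)"
  using assms
proof (induction k)
  case (Suc k)
  have bk: "b ^ k * \<bar>d\<bar> \<le> b ^ Suc k * \<bar>d\<bar>"
    using b1 by (intro mult_right_mono power_increasing) auto
  have "\<bar>(- r) ^ k * c\<bar> \<le> \<bar>c\<bar>"
    using r0 r1 by (simp add: abs_mult power_abs mult_left_le_one_le power_le_one)
  moreover have "\<bar>(- b) ^ k * d\<bar> = b ^ k * \<bar>d\<bar>"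
    using b1 by (simp add: abs_mult power_abs)
  ultimately have "- xX \<le> (- r) ^ k * c + (- b) ^ k * d"
    using Suc.prems bk by linarith
  then show ?case
    using Suc bk by (simp add: f_near_X mult.assoc)
qed simp

subsection \<open>The trapping triangle\<close>

text \<open>After clearing denominators and the factor \<open>b\<close>, the two sides differ by
  \<open>(b + s) * (1 - r - s)\<close>.\<close>

lemma q_lower: "b * r / ((b + r + s) * (1 - s)) < b / (1 + b)"
proof -
  have "b * r < b * (1 - s)" using b1 sr by simp
  moreover have "0 < s * (1 - r - s)" using s0 sr by simp
  ultimately have "r * (1 + b) < (b + r + s) * (1 - s)" by (simp add: algebra_simps)
  then have "b * (r * (1 + b)) < b * ((b + r + s) * (1 - s))" using b1 by simp
  moreover have "0 < (b + r + s) * (1 - s)" using b1 r0 s0 s1 by simp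
  ultimately show ?thesis using b1 by (simp add: divide_simps mult_ac)
qed

text \<open>The stable line of \<open>X\<close> meets the switching line at height
  \<open>- b / (1 + b)\<close>.\<close>

lemma trap_axis:
  assumes "P \<in> trap" "fst P = 0"
  shows "- b / (1 + b) < snd P"
proof -
  have p: "0 < b + r + s" using b1 r0 s0 by simp
  have "- (b * r / (1 - s)) \<le> snd P * (b + r + s)"
    using assms by (simp add: trap_def mult.commute)
  then have "- (b * r / (1 - s)) / (b + r + s) \<le> snd P"
    by (simp only: divide_le_eq p if_True)
  then show ?thesis using q_lower by (simp add: mult.commute)
qed

lemma f_axis:
  assumes "P \<in> trap" "fst P = 0"
  shows "snd (f P) = 0" "1 / (1 + b) < fst (f P)"
proof -
  have "1 - b / (1 + b) = 1 / (1 + b)" using b1 by (simp add: field_simps)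
  then show "snd (f P) = 0" "1 / (1 + b) < fst (f P)"
    using trap_axis[OF assms] assms(2) by (auto simp: f_def AL_def)
qed

lemma trap_fst_le:
  assumes "P \<in> trap" shows "fst P \<le> 1 / (1 - s)"
proof -
  have p: "0 < b + r + s" "0 < b * r" using b1 r0 s0 by auto
  have "snd P \<le> - s * (fst P - 1 / (1 - s))"
    using assms by (simp add: trap_def algebra_simps)
  then have "(b + r + s) * snd P \<le> (b + r + s) * (- s * (fst P - 1 / (1 - s)))"
    using p by (intro mult_left_mono) auto
  then have "b * r * (fst P - 1 / (1 - s)) \<le> (b + r + s) * (- s * (fst P - 1 / (1 - s)))"
    using assms by (simp add: trap_def)
  moreover have "(b * r + (b + r + s) * s) * h = b * r * h - (b + r + s) * (- s * h)" for h
    by (simp add: algebra_simps)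
  ultimately have "(b * r + (b + r + s) * s) * (fst P - 1 / (1 - s)) \<le> 0"
    by simp
  moreover have "0 < b * r + (b + r + s) * s" using p s0 by (simp add: add_pos_pos)
  ultimately show ?thesis by (simp add: mult_le_0_iff)
qed

text \<open>The first two sides meet at the left fixed point; the quotient is its abscissa
  \<open>- 1 / ((a - 1) * (1 - s))\<close>.\<close>

lemma trap_fst_ge:
  assumes "P \<in> trap" shows "- (a / (a - 1) + s / (1 - s)) / (a - s) \<le> fst P"
proof -
  have "0 < a - s" using a1 s1 by simp
  moreover have "- (a / (a - 1) + s / (1 - s)) \<le> fst P * (a - s)"
    using assms by (simp add: trap_def algebra_simps)
  ultimately show ?thesis by (simp add: divide_le_eq)
qed

lemma trap_convex: "convex trap"
proof -
  have "trap = {P. (- a, - 1) \<bullet> P \<le> a / (a - 1)} \<inter> {P. (s, 1) \<bullet> P \<le> s / (1 - s)} \<inter>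
     {P. (b * r, - (b + r + s)) \<bullet> P \<le> b * r / (1 - s)}"
    by (auto simp: trap_def inner_prod_def algebra_simps)
  then show ?thesis by (simp add: convex_Int convex_halfspace_le)
qed

text \<open>On the left, the functionals \<open>a * x + y\<close> and \<open>s * x + y\<close> are
  left eigenvectors of \<open>AL\<close> for \<open>a\<close> and \<open>s\<close>, which preserves
  the first two sides. On the right, the third side lies on the image of the line of the second, and
  the first side is where \<open>trapping\<close> enters.\<close>

lemma trap_f:
  assumes P: "P \<in> trap" shows "f P \<in> trap"
proof -
  obtain x y where xy: "P = (x, y)" by fastforce
  define h where "h = 1 / (1 - s)"
  have s1': "0 < 1 - s" using s1 by simp
  have h: "(1 - s) * h = 1" "0 < h" "s / (1 - s) = s * h" using s1 by (auto simp: h_def)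
  define k where "k = 1 / (a - 1)"
  have k: "(a - 1) * k = 1" "0 < k" "a / (a - 1) = a * k" using a1 by (auto simp: k_def)
  have pos: "0 < b * r" "0 < b + r + s" "0 < a * s" using b1 r0 s0 a1 by auto
  have 1: "0 \<le> a * x + y + a * k" and 2: "s * x + y \<le> s * h"
    and 3: "b * r * (x - h) \<le> (b + r + s) * y"
    using P by (auto simp: trap_def xy h k simp flip: h_def)
  have goal: "f P \<in> trap \<longleftrightarrow> 0 \<le> a * fst (f P) + snd (f P) + a * k \<and> s * fst (f P) + snd (f P) \<le> s * h
      \<and> b * r * (fst (f P) - h) \<le> (b + r + s) * snd (f P)"
    by (auto simp: trap_def h k simp flip: h_def)
  show ?thesis
  proof (cases "x \<le> 0")
    case True
    have e: "fst (f P) = (a + s) * x + y + 1" "snd (f P) = - (a * s) * x"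
      using True by (auto simp: f_def AL_def xy)
    have "a * fst (f P) + snd (f P) + a * k = a * (a * x + y + a * k) - a * ((a - 1) * k - 1)"
      by (simp add: e algebra_simps)
    then have A: "0 \<le> a * fst (f P) + snd (f P) + a * k" using 1 k a1 by simp
    have "s * h - (s * fst (f P) + snd (f P)) = s * (s * h - (s * x + y)) + s * ((1 - s) * h - 1)"
      by (simp add: e algebra_simps)
    then have B: "s * fst (f P) + snd (f P) \<le> s * h" using 2 h s0
      by (smt (verit, best) mult_nonneg_nonneg mult_eq_0_iff)
    have y0: "0 \<le> snd (f P)" using e True pos by (simp add: mult_nonneg_nonpos)
    then have "s * (fst (f P) - h) \<le> 0" using B by (simp add: algebra_simps)
    then have "fst (f P) - h \<le> 0" using s0 by (simp add: mult_le_0_iff)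
    then have "b * r * (fst (f P) - h) \<le> 0" using pos by (simp add: mult_nonneg_nonpos)
    then have C: "b * r * (fst (f P) - h) \<le> (b + r + s) * snd (f P)"
      using y0 pos by (smt (verit) mult_nonneg_nonneg)
    show ?thesis using A B C goal by simp
  next
    case False
    have e: "fst (f P) = - (b + r) * x + y + 1" "snd (f P) = - (b * r) * x"
      using False by (auto simp: f_def AR_def xy)
    have x0: "0 < x" using False by simp
    have xh: "x \<le> h" using trap_fst_le[OF P] by (simp add: xy h_def)
    have "s * h - (s * fst (f P) + snd (f P))
        = s * (s * h - (s * x + y)) + (s * (s + b + r) + b * r) * x + s * ((1 - s) * h - 1)"
      by (simp add: e algebra_simps)
    moreover have "0 \<le> (s * (s + b + r) + b * r) * x" using pos s0 x0 by simp
    moreover have "0 \<le> s * (s * h - (s * x + y))" using s0 2 by simp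
    ultimately have B: "s * fst (f P) + snd (f P) \<le> s * h" using h by simp
    have "(b + r + s) * snd (f P) - b * r * (fst (f P) - h)
        = b * r * (s * h - (s * x + y)) + b * r * ((1 - s) * h - 1)"
      by (simp add: e algebra_simps)
    moreover have "0 \<le> b * r * (s * h - (s * x + y))" using pos 2 by simp
    ultimately have C: "b * r * (fst (f P) - h) \<le> (b + r + s) * snd (f P)" using h by simp
    have T: "a * (b + r) + b * r \<le> a\<^sup>2 * (1 - s) * k"
    proof -
      have "((a - 1) * (a * (b + r) + b * r)) * k \<le> (a\<^sup>2 * (1 - s)) * k"
        using trapping k by (intro mult_right_mono) auto
      moreover have "((a - 1) * (a * (b + r) + b * r)) * k = ((a - 1) * k) * (a * (b + r) + b * r)"
        by (simp only: mult_ac)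
      ultimately show ?thesis using k by simp
    qed
    \<comment> \<open>By \<open>trapping\<close>, the functional of the first side is nonnegative at
      the image of the corner \<open>(h, 0)\<close>.\<close>
    have hk: "(a * (b + r) + b * r) * h \<le> a\<^sup>2 * k"
    proof -
      have "(a * (b + r) + b * r) * h \<le> (a\<^sup>2 * (1 - s) * k) * h"
        using T h by (intro mult_right_mono) auto
      also have "\<dots> = ((1 - s) * h) * (a\<^sup>2 * k)" by (simp only: mult_ac)
      finally show ?thesis using h by simp
    qed
    have yl: "- r * (h - x) \<le> y"
    proof -
      have "(b + r + s) * (- r * (h - x)) \<le> b * r * (x - h)"
      proof -
        have "0 \<le> (r + s) * r * (h - x)" using r0 s0 xh by simp
        then show ?thesis by (simp add: algebra_simps)
      qed
      then have "(b + r + s) * (- r * (h - x)) \<le> (b + r + s) * y" using 3 by linarith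
      then show ?thesis using pos by (meson mult_le_cancel_left_pos)
    qed
    \<comment> \<open>Expansion around the corner \<open>(h, 0)\<close>: the value at its image plus
      nonnegative contributions.\<close>
    have "a * fst (f P) + snd (f P) + a * k
        = a * (y + r * (h - x)) + (a\<^sup>2 * k - (a * (b + r) + b * r) * h)
          + (a * b + b * r) * (h - x) - a * ((a - 1) * k - 1)"
      by (simp add: e algebra_simps power2_eq_square)
    moreover have "0 \<le> a * (y + r * (h - x))" using yl a1 by simp
    moreover have "0 \<le> (a * b + b * r) * (h - x)" using a1 b1 r0 xh by simp
    ultimately have A: "0 \<le> a * fst (f P) + snd (f P) + a * k" using hk k by simp
    show ?thesis using A B C goal by simp
  qed
qed

lemma X_interior: "X \<in> interior trap"
proof -
  let ?U = "{P. a * fst P + snd P + a / (a - 1) > 0} \<inter> {P. s * fst P + snd P < s / (1 - s)} \<inter>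
              {P. b * r * (fst P - 1 / (1 - s)) < (b + r + s) * snd P}"
  have "open ?U"
    by (intro open_Int open_Collect_less continuous_intros)
  moreover have "?U \<subseteq> trap" by (auto simp: trap_def)
  moreover have "X \<in> ?U"
  proof -
    define h where "h = 1 / (1 - s)"
    have h: "(1 - s) * h = 1" "0 < h" "s / (1 - s) = s * h" using s1 by (auto simp: h_def)
    have pos: "0 < b * r" "0 < b + r + s" "0 < a * xX" using b1 r0 s0 a1 xX_pos by auto
    have e: "xX + b * xX + r * xX + b * r * xX = 1" using xX_eq by (simp add: algebra_simps)
    have q: "0 < b * xX" "0 < r * xX" "0 < b * r * xX" using b1 r0 xX_pos by auto
    have x1: "xX < 1" "b * r * xX < 1" using e q xX_pos by linarith+
    have "1 < a / (a - 1)" using a1 by simp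
    then have A: "0 < a * fst X + snd X + a / (a - 1)" using pos x1 by (simp add: X_def)
    have "1 < h" using s0 s1 by (simp add: h_def)
    then have "s * xX < s * h" using x1 s0 by simp
    then have B: "s * fst X + snd X < s * h" using q by (simp add: X_def)
    have "(1 + b + r + s) * (1 - s) < (1 + b) * (1 + r)"
    proof -
      have "0 < b * r + s * (b + r + s)" using pos s0 by (simp add: add_pos_pos)
      then show ?thesis by (simp add: algebra_simps)
    qed
    then have "(1 + b + r + s) * (1 - s) * (xX * h) < (1 + b) * (1 + r) * (xX * h)"
      using xX_pos h by (intro mult_strict_right_mono) auto
    moreover have "(1 + b + r + s) * (1 - s) * (xX * h) = (1 + b + r + s) * xX * ((1 - s) * h)"
      by (simp only: mult_ac)
    moreover have "(1 + b) * (1 + r) * (xX * h) = ((1 + b) * (1 + r) * xX) * h"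
      by (simp only: mult_ac)
    ultimately have "(1 + b + r + s) * xX < h" using h xX_eq by simp
    then have "b * r * ((1 + b + r + s) * xX) < b * r * h" using pos by (intro mult_strict_left_mono)
    then have C: "b * r * (fst X - h) < (b + r + s) * snd X" by (simp add: X_def algebra_simps)
    show ?thesis using A B C by (simp add: h flip: h_def)
  qed
  ultimately show ?thesis by (meson interiorI)
qed

lemma trap_segment:
  assumes "P \<in> trap" "P + D \<in> trap" "0 \<le> u" "u \<le> 1"
  shows "P + u *\<^sub>R D \<in> trap"
proof -
  have "P + u *\<^sub>R D = (1 - u) *\<^sub>R P + u *\<^sub>R (P + D)" by (simp add: algebra_simps)
  then show ?thesis using convexD_alt[OF trap_convex assms(1,2)] assms(3,4) by simp
qed

subsection \<open>Growth of segments\<close>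

lemma cone_scale: "D \<in> cone \<Longrightarrow> k \<noteq> 0 \<Longrightarrow> k *\<^sub>R D \<in> cone"
  by (auto simp: cone_def)

lemma cone_cu: "D \<in> cone \<Longrightarrow> cu D \<noteq> 0"
  using br r1 b1 by (auto simp: cone_def cu_def simp flip: left_diff_distrib)

text \<open>A slope \<open>m\<close> becomes \<open>- (a * s) / (a + s + m)\<close>, which stays
  between \<open>- s\<close> and \<open>0\<close>; the horizontal factor \<open>a + s + m\<close> is
  at least \<open>a\<close> because \<open>- s \<le> m\<close>.\<close>

lemma cone_AL:
  assumes "D \<in> cone"
  shows "AL D \<in> cone" "a * \<bar>fst D\<bar> \<le> \<bar>fst (AL D)\<bar>"
proof -
  obtain m where m: "fst D \<noteq> 0" "- s \<le> m" "m \<le> r" "snd D = m * fst D"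
    using assms by (auto simp: cone_def)
  have p: "a \<le> a + s + m" "0 < a + s + m" using m a1 by auto
  have e: "fst (AL D) = (a + s + m) * fst D" using m by (simp add: AL_def algebra_simps)
  show "a * \<bar>fst D\<bar> \<le> \<bar>fst (AL D)\<bar>" using p by (simp add: e abs_mult mult_right_mono)
  have "snd (AL D) = - (a * s / (a + s + m)) * fst (AL D)"
  proof -
    have "snd (AL D) = - (a * s) * fst D" by (simp add: AL_def)
    then show ?thesis unfolding e using p by simp
  qed
  moreover have "a * s / (a + s + m) \<le> s" 
    using p s0 by (simp add: pos_divide_le_eq mult.commute)
  moreover have "0 \<le> a * s / (a + s + m)" using a1 s0 p by simp
  moreover have "fst (AL D) \<noteq> 0" using p m by (simp add: e)
  ultimately show "AL D \<in> cone" unfolding cone_def using r0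
    by (auto intro!: exI[of _ "- (a * s / (a + s + m))"])
qed

lemma cone_AR:
  assumes "D \<in> cone"
  shows "AR D \<in> cone" "b * \<bar>fst D\<bar> \<le> \<bar>fst (AR D)\<bar>"
proof -
  obtain m where m: "fst D \<noteq> 0" "- s \<le> m" "m \<le> r" "snd D = m * fst D"
    using assms by (auto simp: cone_def)
  have p: "b \<le> b + r - m" "0 < b + r - m" using m b1 by auto
  have e: "fst (AR D) = - (b + r - m) * fst D" using m by (simp add: AR_def algebra_simps)
  have "\<bar>fst (AR D)\<bar> = (b + r - m) * \<bar>fst D\<bar>" unfolding e abs_mult using p by simp
  then show "b * \<bar>fst D\<bar> \<le> \<bar>fst (AR D)\<bar>" using p by (simp add: mult_right_mono)
  have "snd (AR D) = (b * r / (b + r - m)) * fst (AR D)"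
  proof -
    have "snd (AR D) = - (b * r) * fst D" by (simp add: AR_def)
    then show ?thesis unfolding e using p by (simp add: field_simps)
  qed
  moreover have "b * r / (b + r - m) \<le> r"
    using p r0 by (simp add: pos_divide_le_eq mult.commute)
  moreover have "0 \<le> b * r / (b + r - m)" using b1 r0 p by simp
  moreover have "fst (AR D) \<noteq> 0" using p m by (simp add: e)
  ultimately show "AR D \<in> cone" unfolding cone_def using s0
    by (auto intro!: exI[of _ "b * r / (b + r - m)"])
qed

text \<open>\<^term>\<open>homoclinic P D\<close>: some iterate is affine near an interior point of the segment from
  \<^term>\<open>P\<close> to \<^term>\<open>P + D\<close> and maps that point transversally to the local stable manifold
  of \<^term>\<open>X\<close>, the segment \<^term>\<open>X + E t 0\<close> with \<^term>\<open>- xX < t\<close>, \<^term>\<open>t < xX / r\<close>.\<close>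

definition homoclinic :: "real \<times> real \<Rightarrow> real \<times> real \<Rightarrow> bool" where
  "homoclinic P D \<longleftrightarrow> (\<exists>n u t M \<epsilon>. 0 < u \<and> u < 1 \<and> linear M \<and> 0 < \<epsilon> \<and> - xX < t \<and> t < xX / r \<and>
     cu (M D) \<noteq> 0 \<and> (\<forall>v. norm v < \<epsilon> \<longrightarrow> (f ^^ n) (P + u *\<^sub>R D + v) = X + E t 0 + M v))"

text \<open>\<open>k\<close> may be negative: both pieces of a cut segment are based at the cutting
  point, so one of them runs backwards.\<close>

lemma homoclinic_subsegment:
  assumes "homoclinic (P + u1 *\<^sub>R D) (k *\<^sub>R D)" "0 \<le> u1" "u1 \<le> 1" "0 \<le> u1 + k" "u1 + k \<le> 1" 
  shows "homoclinic P D"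
proof -
  obtain n u t M \<epsilon> where h: "0 < u" "u < 1" "linear M" "0 < \<epsilon>" "- xX < t" "t < xX / r"
    "cu (M (k *\<^sub>R D)) \<noteq> 0"
    "\<forall>v. norm v < \<epsilon> \<longrightarrow> (f ^^ n) (P + u1 *\<^sub>R D + u *\<^sub>R k *\<^sub>R D + v) = X + E t 0 + M v"
    using assms(1) unfolding homoclinic_def by metis
  have "cu (M (k *\<^sub>R D)) = k * cu (M D)"
    by (simp add: linear_scale[OF h(3)] linear_scale[OF linear_cu])
  then have k: "k \<noteq> 0" "cu (M D) \<noteq> 0" using h(7) by auto
  have e: "P + u1 *\<^sub>R D + u *\<^sub>R k *\<^sub>R D = P + (u1 + u * k) *\<^sub>R D" by (simp add: algebra_simps)
  have "0 < u1 + u * k \<and> u1 + u * k < 1"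
  proof (cases "0 < k")
    case True
    then have "0 < u * k" "u * k < k" using h(1,2) by auto
    then show ?thesis using assms by linarith
  next
    case False
    then have "u * k < 0" "k < u * k" using h(1,2) k by (auto simp: mult_pos_neg)
    then show ?thesis using assms by linarith
  qed
  then show ?thesis unfolding homoclinic_def using h k e by metis
qed

text \<open>An affine branch pulls the data back: the iterate gains a step, \<open>M\<close> becomes
  \<open>M \<circ> A\<close> and the ball shrinks. Since a full ball is needed, only the open
  segment has to lie in the open set \<open>U\<close>.\<close>

lemma homoclinic_image:
  assumes A: "linear A" and hom: "homoclinic (A P + (1, 0)) (A D)"
    and U: "open U" "\<And>Q. Q \<in> U \<Longrightarrow> f Q = A Q + (1, 0)"
    and seg: "\<And>u. 0 < u \<Longrightarrow> u < 1 \<Longrightarrow> P + u *\<^sub>R D \<in> U"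
  shows "homoclinic P D"
proof -
  obtain n u t M \<epsilon> where h: "0 < u" "u < 1" "linear M" "0 < \<epsilon>" "- xX < t" "t < xX / r"
    "cu (M (A D)) \<noteq> 0"
    "\<And>v. norm v < \<epsilon> \<Longrightarrow> (f ^^ n) (A P + (1, 0) + u *\<^sub>R A D + v) = X + E t 0 + M v"
    using hom unfolding homoclinic_def by metis
  obtain \<delta> where d: "0 < \<delta>" "ball (P + u *\<^sub>R D) \<delta> \<subseteq> U"
    using seg[OF h(1,2)] U(1) openE by blast
  obtain B where B: "B > 0" "\<And>v. norm (A v) \<le> B * norm v"
    using A linear_bounded_pos by blast
  have "(f ^^ Suc n) (P + u *\<^sub>R D + v) = X + E t 0 + (M \<circ> A) v" if "norm v < min \<delta> (\<epsilon> / B)" for v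
  proof -
    have "P + u *\<^sub>R D + v \<in> U" using that d by (intro subsetD[OF d(2)]) (simp add: dist_norm)
    then have "f (P + u *\<^sub>R D + v) = A (P + u *\<^sub>R D + v) + (1, 0)" by (rule U)
    also have "\<dots> = A P + (1, 0) + u *\<^sub>R A D + A v"
      by (simp add: linear_add[OF A] linear_scale[OF A] algebra_simps)
    finally have 1: "f (P + u *\<^sub>R D + v) = A P + (1, 0) + u *\<^sub>R A D + A v" .
    have "norm v * B < \<epsilon>" using that B by (simp add: pos_less_divide_eq)
    then have "norm (A v) < \<epsilon>" using B(2)[of v] by (simp add: mult.commute)
    then show ?thesis using h(8)[of "A v"] 1 by (simp add: funpow_Suc_right del: funpow.simps)
  qed
  moreover have "linear (M \<circ> A)" using A h(3) by (simp add: linear_compose)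
  moreover have "0 < min \<delta> (\<epsilon> / B)" using d B h(4) by simp
  ultimately show ?thesis unfolding homoclinic_def using h(1,2,5,6,7)
    by (intro exI[of _ "Suc n"] exI[of _ u] exI[of _ t] exI[of _ "M \<circ> A"]
        exI[of _ "min \<delta> (\<epsilon> / B)"]) auto
qed

lemma fst_segment:
  "fst (P + u *\<^sub>R D) = (1 - u) * fst P + u * fst (P + D)"
  by (simp add: algebra_simps)

text \<open>An endpoint may sit on the switching line; \<open>fst D \<noteq> 0\<close> still puts
  the open segment into the open half-plane.\<close>

lemma homoclinic_right:
  assumes "homoclinic (AR P + (1, 0)) (AR D)" "0 \<le> fst P" "0 \<le> fst (P + D)" "fst D \<noteq> 0"
  shows "homoclinic P D"
proof (rule homoclinic_image[OF linear_AR assms(1)])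
  show "open {Q :: real \<times> real. 0 < fst Q}" by (intro open_Collect_less continuous_intros)
  show "P + u *\<^sub>R D \<in> {Q. 0 < fst Q}" if "0 < u" "u < 1" for u
  proof -
    have "0 < fst P \<or> 0 < fst (P + D)" using assms by auto
    then have "0 < (1 - u) * fst P \<or> 0 < u * fst (P + D)" using that by (auto simp del: fst_add)
    moreover have "0 \<le> (1 - u) * fst P" "0 \<le> u * fst (P + D)"
      using that assms by (auto simp del: fst_add)
    ultimately show ?thesis unfolding mem_Collect_eq fst_segment by linarith
  qed
qed (simp add: f_right)

lemma homoclinic_left:
  assumes "homoclinic (AL P + (1, 0)) (AL D)" "fst P \<le> 0" "fst (P + D) \<le> 0" "fst D \<noteq> 0"
  shows "homoclinic P D"
proof (rule homoclinic_image[OF linear_AL assms(1)])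
  show "open {Q :: real \<times> real. fst Q < 0}" by (intro open_Collect_less continuous_intros)
  show "P + u *\<^sub>R D \<in> {Q. fst Q < 0}" if "0 < u" "u < 1" for u
  proof -
    have "fst P < 0 \<or> fst (P + D) < 0" using assms by auto
    then have "(1 - u) * fst P < 0 \<or> u * fst (P + D) < 0"
      using that by (auto simp: mult_pos_neg simp del: fst_add)
    moreover have "(1 - u) * fst P \<le> 0" "u * fst (P + D) \<le> 0"
      using that assms by (auto simp: mult_nonneg_nonpos simp del: fst_add)
    ultimately show ?thesis unfolding mem_Collect_eq fst_segment by linarith
  qed
qed (simp add: f_left)

text \<open>The line \<^term>\<open>snd Q = b * fst Q - b / (1 + b)\<close> carries the stable manifold of \<^term>\<open>X\<close>;
  it separates \<^term>\<open>P\<close> from the part of the axis \<^term>\<open>fst Q = 0\<close> inside the trapping triangle.\<close>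

lemma homoclinic_crossing:
  assumes P: "P \<in> trap" "snd P = 0" "1 / (1 + b) < fst P"
    and PD: "P + D \<in> trap" "fst (P + D) \<le> 0" and D: "D \<in> cone"
  shows "homoclinic P D"
proof -
  have P0: "0 < fst P" using P b1 by (smt (verit) divide_pos_pos)
  define u1 where "u1 = fst P / - fst D"
  have D0: "fst D < 0" "fst P \<le> - fst D" using PD P0 by auto
  have u1: "0 < u1" "u1 \<le> 1" "fst P + u1 * fst D = 0" using P0 D0 by (auto simp: u1_def divide_simps)
  have "P + u1 *\<^sub>R D \<in> trap" using trap_segment P PD u1 by simp
  from trap_axis[OF this] have y: "- b / (1 + b) < snd (P + u1 *\<^sub>R D)" using u1 by simp
  \<comment> \<open>The height above the stable line of \<open>X\<close>, negative at
    \<open>P\<close> and positive where the segment meets the switching line.\<close>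
  define \<psi> where "\<psi> u = snd (P + u *\<^sub>R D) - b * fst (P + u *\<^sub>R D) + b / (1 + b)" for u
  have "b * (1 / (1 + b)) < b * fst P" using P b1 by (intro mult_strict_left_mono) auto
  then have "\<psi> 0 < 0" using P by (simp add: \<psi>_def)
  moreover have "0 < \<psi> u1" using y u1 by (simp add: \<psi>_def)
  moreover have "continuous_on {0..u1} \<psi>" unfolding \<psi>_def by (intro continuous_intros)
  ultimately obtain u where u: "0 \<le> u" "u \<le> u1" "\<psi> u = 0" using u1 IVT'[of \<psi> 0 0 u1] by auto
  have u_ne: "u \<noteq> 0" "u \<noteq> u1" using u \<open>\<psi> 0 < 0\<close> \<open>0 < \<psi> u1\<close> by auto
  then have u01: "0 < u" "u < 1" using u u1 by auto
  define x where "x = fst (P + u *\<^sub>R D)"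
  have "u1 * fst D < u * fst D" using D0 u u_ne by simp
  then have x0: "0 < x" using u1 by (simp add: x_def)
  have sx: "snd (P + u *\<^sub>R D) = b * x - b / (1 + b)" using u by (simp add: \<psi>_def x_def)
  have "P + u *\<^sub>R D \<in> trap" using trap_segment P PD u01 by simp
  then have "s * x + (b * x - b / (1 + b)) \<le> s / (1 - s)" using sx by (simp add: trap_def x_def)
  then have "(b + s) * x \<le> s / (1 - s) + b / (1 + b)" by (simp add: algebra_simps)
  also have "\<dots> = (b + s) * (1 / ((1 - s) * (1 + b)))" using s1 b1
    by (simp add: add_frac_eq algebra_simps)
  finally have "x \<le> 1 / ((1 - s) * (1 + b))" using b1 s0
    by (meson mult_le_cancel_left_pos add_pos_pos less_trans zero_less_one)
  \<comment> \<open>The right-hand side is the abscissa at which the local stable segment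
    ends.\<close>
  also have "\<dots> < 1 / (r * (1 + b))" using sr r0 b1 by (intro divide_strict_left_mono) auto
  also have "\<dots> = xX + xX / r" using b1 r0
    by (simp add: xX_def add_frac_eq divide_simps)
  finally have x1: "x - xX < xX / r" by simp
  have "b / (1 + b) = b * (1 + r) * xX" using b1 r0 by (simp add: xX_def)
  then have e: "P + u *\<^sub>R D = X + E (x - xX) 0"
    using sx by (simp add: X_def E_def prod_eq_iff x_def algebra_simps)
  \<comment> \<open>The crossing point is already on the local stable segment, so zero iterates and
    \<open>M = id\<close> suffice.\<close>
  show ?thesis unfolding homoclinic_def
    by (intro exI[of _ 0] exI[of _ u] exI[of _ "x - xX"] exI[of _ id] exI[of _ 1])
      (use u01 x0 x1 e cone_cu[OF D] linear_id in auto)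
qed

lemma f_segment_left:
  "fst P \<le> 0 \<Longrightarrow> fst (P + D) \<le> 0 \<Longrightarrow> f (P + D) = AL P + (1, 0) + AL D"
  by (subst f_left) (auto simp: linear_add[OF linear_AL] simp del: fst_add)

lemma f_segment_right:
  "0 \<le> fst P \<Longrightarrow> 0 \<le> fst (P + D) \<Longrightarrow> f (P + D) = AR P + (1, 0) + AR D"
  by (subst f_right) (auto simp: linear_add[OF linear_AR] simp del: fst_add)

text \<open>A common growth rate: \<open>a\<close> and \<open>b\<close> cover uncut segments, and
  \<open>a * b^2 / (a + b)\<close> covers the least favourable cut.\<close>

lemma growth_exists: "\<exists>\<rho>>1. \<rho> \<le> a \<and> \<rho> \<le> b \<and> \<rho> * (a + b) \<le> a * b\<^sup>2"
proof -
  have "1 < a * b\<^sup>2 / (a + b)" using expansion a1 b1 by simp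
  moreover have "min (min a b) (a * b\<^sup>2 / (a + b)) * (a + b) \<le> a * b\<^sup>2 / (a + b) * (a + b)"
    using a1 b1 by (intro mult_right_mono) auto
  ultimately show ?thesis using a1 b1
    by (intro exI[of _ "min (min a b) (a * b\<^sup>2 / (a + b))"]) auto
qed

text \<open>Cutting a segment at the switching line produces a left and a right piece. Unless the image of
  one of them crosses the local stable manifold, a further step stretches them by
  \<^term>\<open>a * b\<close> and \<^term>\<open>b\<^sup>2\<close>, so one of them outgrows the whole.\<close>

lemma homoclinic_exists:
  assumes "P \<in> trap" "P + D \<in> trap" "D \<in> cone"
  shows "homoclinic P D"
proof (rule ccontr)
  obtain \<rho> where \<rho>: "1 < \<rho>" "\<rho> \<le> a" "\<rho> \<le> b" "\<rho> * (a + b) \<le> a * b\<^sup>2"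
    using growth_exists by blast
  \<comment> \<open>A counterexample of horizontal length at least \<open>l\<close>. Repeated growth
    by the factor \<open>\<rho>\<close> will contradict the bounded width of the triangle.\<close>
  define bad where "bad l \<longleftrightarrow> (\<exists>P D. P \<in> trap \<and> P + D \<in> trap \<and> D \<in> cone \<and> \<not> homoclinic P D \<and> l \<le> \<bar>fst D\<bar>)"
    for l
  have step_right: "bad (\<rho> * l)" if "P \<in> trap" "P + D \<in> trap" "D \<in> cone" "\<not> homoclinic P D"
    "0 \<le> fst P" "0 \<le> fst (P + D)" "\<rho> * l \<le> b * \<bar>fst D\<bar>" for P D l
  proof -
    have "fst D \<noteq> 0" using that by (simp add: cone_def)
    then have "\<not> homoclinic (AR P + (1, 0)) (AR D)" using homoclinic_right that by blast
    moreover have "AR P + (1, 0) \<in> trap" using trap_f[OF that(1)] f_right that(5) by simp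
    moreover have "AR P + (1, 0) + AR D \<in> trap" using trap_f[OF that(2)] f_segment_right that by simp
    ultimately show ?thesis unfolding bad_def using cone_AR[OF that(3)] that(7)
      by (intro exI[of _ "AR P + (1, 0)"] exI[of _ "AR D"]) auto
  qed
  have step_left: "bad (\<rho> * l)" if "P \<in> trap" "P + D \<in> trap" "D \<in> cone" "\<not> homoclinic P D"
    "fst P \<le> 0" "fst (P + D) \<le> 0" "\<rho> * l \<le> a * \<bar>fst D\<bar>" for P D l
  proof -
    have "fst D \<noteq> 0" using that by (simp add: cone_def)
    then have "\<not> homoclinic (AL P + (1, 0)) (AL D)" using homoclinic_left that by blast
    moreover have "AL P + (1, 0) \<in> trap" using trap_f[OF that(1)] f_left that(5) by simp
    moreover have "AL P + (1, 0) + AL D \<in> trap" using trap_f[OF that(2)] f_segment_left that by simp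
    ultimately show ?thesis unfolding bad_def using cone_AL[OF that(3)] that(7)
      by (intro exI[of _ "AL P + (1, 0)"] exI[of _ "AL D"]) auto
  qed
  have step_axis: "bad (\<rho> * l)" if "C \<in> trap" "fst C = 0" "C + D \<in> trap" "D \<in> cone"
    "\<not> homoclinic C D" "\<rho> * l \<le> (if 0 < fst D then b * b else a * b) * \<bar>fst D\<bar>" for C D l
  proof -
    define A where "A = (if 0 < fst D then AR else AL)"
    have D0: "fst D \<noteq> 0" using that by (simp add: cone_def)
    have fC: "f C = A C + (1, 0)" using f_left[of C] f_right[of C] that by (simp add: A_def)
    have fD: "f (C + D) = f C + A D"
      using f_segment_left[of C D] f_segment_right[of C D] that fC by (auto simp: A_def)
    have AD: "A D \<in> cone" using cone_AL cone_AR that by (simp add: A_def)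
    have n: "\<not> homoclinic (f C) (A D)"
      using homoclinic_left[of C D] homoclinic_right[of C D] that fC D0 by (auto simp: A_def split: if_splits)
    have t: "f C \<in> trap" "f C + A D \<in> trap" using trap_f that fD by metis+
    have ax: "snd (f C) = 0" "1 / (1 + b) < fst (f C)" using f_axis that by auto
    \<comment> \<open>Reaching the switching line would force a crossing, so the image stays on the
      right and the next step stretches by \<open>b\<close>.\<close>
    then have pos: "0 < fst (f C + A D)" using homoclinic_crossing[OF t(1) ax t(2) _ AD] n by linarith
    have pos': "0 \<le> fst (f C)" using ax b1 by (smt (verit) divide_pos_pos)
    have "(if 0 < fst D then b else a) * \<bar>fst D\<bar> \<le> \<bar>fst (A D)\<bar>"
      using cone_AL(2)[OF that(4)] cone_AR(2)[OF that(4)] by (auto simp: A_def)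
    then have "b * ((if 0 < fst D then b else a) * \<bar>fst D\<bar>) \<le> b * \<bar>fst (A D)\<bar>"
      using b1 by (intro mult_left_mono) auto
    then have "\<rho> * l \<le> b * \<bar>fst (A D)\<bar>" using that(6) by (simp add: mult_ac split: if_splits)
    then show ?thesis using step_right[OF t(1) t(2) AD n pos'] pos by simp
  qed
  have grow: "bad (\<rho> * l)" if bad: "bad l" and lpos: "0 < l" for l
  proof -
    obtain P D where P: "P \<in> trap" "P + D \<in> trap" "D \<in> cone" "\<not> homoclinic P D" "l \<le> \<bar>fst D\<bar>"
      using bad unfolding bad_def by blast
    have D0: "fst D \<noteq> 0" using P by (simp add: cone_def)
    have l: "\<rho> * l \<le> \<rho> * \<bar>fst D\<bar>" using \<rho> P by simp
    consider "0 \<le> fst P" "0 \<le> fst (P + D)" | "fst P \<le> 0" "fst (P + D) \<le> 0"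
      | "fst P * fst (P + D) < 0" by (smt (verit) mult_neg_pos mult_pos_neg)
    then show ?thesis
    proof cases
      case 1
      then show ?thesis using step_right[OF P(1-4)] l \<rho>
        by (smt (verit, ccfv_SIG) mult_right_mono abs_ge_zero)
    next
      case 2
      then show ?thesis using step_left[OF P(1-4)] l \<rho>
        by (smt (verit, ccfv_SIG) mult_right_mono abs_ge_zero)
    next
      case 3
      define u where "u = - fst P / fst D"
      have uD: "u * fst D = - fst P" using D0 by (simp add: u_def)
      have u01: "0 < u" "u < 1"
      proof -
        have "fst P * (fst P + fst D) < 0" using 3 by simp
        then have "(- u * fst D) * ((1 - u) * fst D) < 0" using uD by (simp add: algebra_simps)
        then have "0 < u * (1 - u) * (fst D * fst D)" by (simp add: algebra_simps)
        then have "0 < u * (1 - u)" using D0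
          by (smt (verit) mult_nonpos_nonneg zero_le_square)
        then show "0 < u" "u < 1" by (auto simp: zero_less_mult_iff)
      qed
      define C where "C = P + u *\<^sub>R D"
      have C: "C \<in> trap" "fst C = 0" using trap_segment[OF P(1,2)] u01 uD by (auto simp: C_def)
      have n1: "\<not> homoclinic C ((1 - u) *\<^sub>R D)" "\<not> homoclinic C ((- u) *\<^sub>R D)"
        using homoclinic_subsegment[of P u D "1 - u"] homoclinic_subsegment[of P u D "- u"] P u01
        by (auto simp: C_def)
      have c1: "C + (1 - u) *\<^sub>R D \<in> trap" "C + (- u) *\<^sub>R D \<in> trap"
        using P by (simp_all add: C_def algebra_simps)
      have k: "(1 - u) *\<^sub>R D \<in> cone" "(- u) *\<^sub>R D \<in> cone"
        using cone_scale[OF P(3), of "1 - u"] cone_scale[OF P(3), of "- u"] u01 by auto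
      \<comment> \<open>Otherwise \<open>x + y < \<rho> * l * (1 / b^2 + 1 / (a * b))\<close>, which
        is at most \<open>l\<close>.\<close>
      have pieces: "\<rho> * l \<le> b * b * x \<or> \<rho> * l \<le> a * b * y" if "l \<le> x + y" for x y
      proof (rule ccontr)
        assume "\<not> ?thesis"
        then have "a * (b * b * x) < a * (\<rho> * l)" "b * (a * b * y) < b * (\<rho> * l)"
          using a1 b1 by auto
        moreover have "a * (b * b * x) + b * (a * b * y) = a * b\<^sup>2 * (x + y)"
          "a * (\<rho> * l) + b * (\<rho> * l) = (\<rho> * (a + b)) * l"
          by (simp_all add: algebra_simps power2_eq_square)
        ultimately have lt: "a * b\<^sup>2 * (x + y) < (\<rho> * (a + b)) * l" by linarith
        have "0 < a * b\<^sup>2" "0 < \<rho> * (a + b)" using a1 b1 \<rho> by auto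
        moreover have "a * b\<^sup>2 * l \<le> a * b\<^sup>2 * (x + y)" using that a1 by (intro mult_left_mono) auto
        ultimately have "0 < (\<rho> * (a + b) - a * b\<^sup>2) * l" using lt by (simp add: algebra_simps)
        then have "l < 0" using \<rho>(4) by (auto simp: zero_less_mult_iff)
        then show False using lpos by simp
      qed
      show ?thesis
      proof (cases "0 < fst D")
        case True
        then have "l \<le> \<bar>fst ((1 - u) *\<^sub>R D)\<bar> + \<bar>fst ((- u) *\<^sub>R D)\<bar>"
          using P(5) u01 by (simp add: abs_mult algebra_simps)
        moreover have "0 < fst ((1 - u) *\<^sub>R D)" "\<not> 0 < fst ((- u) *\<^sub>R D)"
          using True u01 by (auto simp: not_less)
        ultimately show ?thesis using pieces step_axis[OF C c1(1) k(1) n1(1)] step_axis[OF C c1(2) k(2) n1(2)]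
          by metis
      next
        case False
        then have "l \<le> \<bar>fst ((- u) *\<^sub>R D)\<bar> + \<bar>fst ((1 - u) *\<^sub>R D)\<bar>"
          using P(5) u01 by (simp add: abs_mult algebra_simps)
        moreover have "\<not> 0 < fst ((1 - u) *\<^sub>R D)" "0 < fst ((- u) *\<^sub>R D)"
          using False D0 u01 by (auto simp: not_less mult_nonneg_nonpos mult_pos_neg)
        ultimately show ?thesis using pieces step_axis[OF C c1(1) k(1) n1(1)] step_axis[OF C c1(2) k(2) n1(2)]
          by metis
      qed
    qed
  qed
  assume "\<not> homoclinic P D"
  then have "bad \<bar>fst D\<bar>" unfolding bad_def using assms by blast
  moreover have l0: "0 < \<bar>fst D\<bar>" using assms by (simp add: cone_def)
  ultimately have all: "bad (\<rho> ^ n * \<bar>fst D\<bar>)" for n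
  proof (induction n)
    case (Suc n)
    then show ?case using grow[of "\<rho> ^ n * \<bar>fst D\<bar>"] \<rho> by (simp add: mult.assoc)
  qed simp
  define lo hi where "lo = - (a / (a - 1) + s / (1 - s)) / (a - s)" and "hi = 1 / (1 - s)"
  define W where "W = hi - lo"
  have W: "l \<le> W" if bad: "bad l" for l
  proof -
    obtain Q D' where Q: "Q \<in> trap" "Q + D' \<in> trap" "l \<le> \<bar>fst D'\<bar>"
      using bad unfolding bad_def by blast
    have "fst Q \<le> hi" "lo \<le> fst Q" "fst Q + fst D' \<le> hi" "lo \<le> fst Q + fst D'"
      using Q(1,2)[THEN trap_fst_le] Q(1,2)[THEN trap_fst_ge] by (simp_all add: hi_def lo_def)
    then show ?thesis using Q(3) by (simp add: W_def)
  qed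
  obtain n where "W / \<bar>fst D\<bar> < \<rho> ^ n" using real_arch_pow \<rho>(1) by blast
  then have "W < \<rho> ^ n * \<bar>fst D\<bar>" using l0 by (simp add: pos_divide_less_eq)
  then show False using W[OF all[of n]] by simp
qed


subsection \<open>Homoclinic points near the local unstable manifold\<close>

text \<open>Iteration along the local stable segment multiplies \<open>t\<close> by
  \<open>- r\<close>, and \<open>M\<close> picks up a factor \<open>AR\<close>, which keeps it
  transversal.\<close>

lemma homoclinic_near_X:
  assumes "homoclinic P D" "0 < \<tau>"
  obtains n u t M \<epsilon> where "0 < u" "u < 1" "linear M" "0 < \<epsilon>" "\<bar>t\<bar> < \<tau>" "cu (M D) \<noteq> 0"
    "\<And>v. norm v < \<epsilon> \<Longrightarrow> (f ^^ n) (P + u *\<^sub>R D + v) = X + E t 0 + M v"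
proof -
  obtain n u t M \<epsilon> where h: "0 < u" "u < 1" "linear M" "0 < \<epsilon>" "- xX < t" "t < xX / r"
    "cu (M D) \<noteq> 0"
    "\<And>v. norm v < \<epsilon> \<Longrightarrow> (f ^^ n) (P + u *\<^sub>R D + v) = X + E t 0 + M v"
    using assms(1) unfolding homoclinic_def by metis
  have "\<exists>M \<epsilon>. linear M \<and> 0 < \<epsilon> \<and> - xX < (- r) ^ j * t \<and> (- r) ^ j * t < xX / r \<and> cu (M D) \<noteq> 0 \<and>
      (\<forall>v. norm v < \<epsilon> \<longrightarrow> (f ^^ (j + n)) (P + u *\<^sub>R D + v) = X + E ((- r) ^ j * t) 0 + M v)" for j
  proof (induction j)
    case 0
    then show ?case using h by auto
  next
    case (Suc j)
    define c where "c = (- r) ^ j * t"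
    obtain M \<epsilon> where M: "linear M" "0 < \<epsilon>" "- xX < c" "c < xX / r" "cu (M D) \<noteq> 0"
      "\<And>v. norm v < \<epsilon> \<Longrightarrow> (f ^^ (j + n)) (P + u *\<^sub>R D + v) = X + E c 0 + M v"
      using Suc unfolding c_def by blast
    obtain B where B: "B > 0" "\<And>v. norm (M v) \<le> B * norm v"
      using M(1) linear_bounded_pos by blast
    \<comment> \<open>The unperturbed point has abscissa \<open>c + xX\<close>, so within this
      radius \<open>M v\<close> cannot carry it across the switching line.\<close>
    define \<epsilon>' where "\<epsilon>' = min \<epsilon> ((c + xX) / B)"
    have "(f ^^ (Suc j + n)) (P + u *\<^sub>R D + v) = X + E (- r * c) 0 + (AR \<circ> M) v" if "norm v < \<epsilon>'" for v
    proof -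
      have "norm v * B < c + xX" using that B by (simp add: \<epsilon>'_def pos_less_divide_eq)
      then have "\<bar>fst (M v)\<bar> < c + xX"
        using B(2)[of v] norm_fst_le[of "fst (M v)" "snd (M v)"] by (simp add: mult.commute)
      moreover have "fst (M v) = cs (M v) + cu (M v)" by (subst E_cs_cu[symmetric]) (simp add: E_def)
      ultimately have "- xX \<le> (c + cs (M v)) + cu (M v)" by linarith
      from f_near_X[OF this]
      have "f (X + (E c 0 + M v)) = X + (E (- r * c) 0 + AR (M v))"
        using E_add[of c 0 "cs (M v)" "cu (M v)"] E_add[of "- r * c" 0 "- r * cs (M v)" "- b * cu (M v)"]
          AR_E[of "cs (M v)" "cu (M v)"]
        by (simp add: E_cs_cu algebra_simps)
      then show ?thesis using M(6)[of v] that by (simp add: \<epsilon>'_def add.assoc)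
    qed
    moreover have "linear (AR \<circ> M)" using M(1) linear_AR by (rule linear_compose)
    moreover have "0 < \<epsilon>'" using M B by (simp add: \<epsilon>'_def)
    moreover have "cu ((AR \<circ> M) D) \<noteq> 0"
    proof -
      have "AR (M D) = E (- r * cs (M D)) (- b * cu (M D))" by (metis AR_E E_cs_cu)
      then show ?thesis using M(5) b1 by simp
    qed
    moreover have "- xX < - r * c" "- r * c < xX / r"
    proof -
      have "r * c < r * (xX / r)" "r * (- xX) < r * c"
        using M r0 by (simp_all only: mult_less_cancel_left_pos)
      then have "r * c < xX" "- r * c < r * xX" using r0 by auto
      moreover have "r * xX < xX" "xX < xX / r" using r0 r1 xX_pos by (auto simp: less_divide_eq)
      ultimately show "- xX < - r * c" "- r * c < xX / r" by auto
    qed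
    moreover have "(- r) ^ Suc j * t = - r * c" by (simp add: c_def)
    ultimately show ?case by metis
  qed
  moreover have "(\<lambda>j. (- r) ^ j * t) \<longlonglongrightarrow> 0"
    using r0 r1 by (intro tendsto_mult_left_zero LIMSEQ_power_zero) auto
  then obtain j where "\<bar>(- r) ^ j * t\<bar> < \<tau>"
    using assms(2) LIMSEQ_D[of _ 0 \<tau>] by fastforce
  ultimately show ?thesis using that h(1,2) by metis
qed

lemma Eu_cone: "d \<noteq> 0 \<Longrightarrow> E 0 d \<in> cone"
  using s0 r0 by (auto simp: cone_def E_def intro: exI[of _ r])

lemma local_unstable_in_trap:
  obtains \<eta> where "0 < \<eta>" "\<eta> < xX / 4" "\<forall>c. \<bar>c\<bar> \<le> \<eta> \<longrightarrow> X + E 0 c \<in> trap"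
proof -
  obtain e where e: "0 < e" "ball X e \<subseteq> trap"
    using X_interior mem_interior by blast
  define N where "N = norm (E 0 1)"
  define \<eta> where "\<eta> = min (xX / 8) (e / (2 * (N + 1)))"
  have N: "0 \<le> N" by (simp add: N_def)
  have "X + E 0 c \<in> trap" if "\<bar>c\<bar> \<le> \<eta>" for c
  proof -
    have "norm (E 0 c) \<le> N * \<bar>c\<bar>" using norm_E_le[of 0 c] by (simp add: N_def)
    also have "\<dots> \<le> (N + 1) * \<eta>" using that N by (intro mult_mono) auto
    also have "\<dots> \<le> (N + 1) * (e / (2 * (N + 1)))" using N by (intro mult_left_mono) (auto simp: \<eta>_def)
    also have "\<dots> = e / 2" using N by (simp add: divide_simps)
    finally have "norm (E 0 c) < e" using e by simp
    then show ?thesis using e(2) by (auto simp: dist_norm)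
  qed
  moreover have "0 < \<eta>" "\<eta> < xX / 4" using xX_pos e N by (auto simp: \<eta>_def)
  ultimately show ?thesis using that by blast
qed

text \<open>Unstable pieces have slope \<open>r\<close> and thus lie in the cone, so homoclinic
  points are dense in the local unstable segment; this feeds both the spreading and the periodic
  points.\<close>

lemma unstable_segment_homoclinic:
  assumes "\<forall>c. \<bar>c\<bar> \<le> \<eta> \<longrightarrow> X + E 0 c \<in> trap" "- \<eta> \<le> w1" "w1 < w2" "w2 \<le> \<eta>" "0 < \<tau>"
  shows "\<exists>n w t M \<epsilon>. w1 < w \<and> w < w2 \<and> linear M \<and> 0 < \<epsilon> \<and> \<bar>t\<bar> < \<tau> \<and> cu (M (E 0 1)) \<noteq> 0 \<and>
    (\<forall>v. norm v < \<epsilon> \<longrightarrow> (f ^^ n) (X + E 0 w + v) = X + E t 0 + M v)"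
proof -
  have eD: "E 0 (w2 - w1) = (w2 - w1) *\<^sub>R E 0 1" by (simp add: E_scale)
  have "X + E 0 w1 \<in> trap" using assms by simp
  moreover have "X + E 0 w1 + E 0 (w2 - w1) \<in> trap" using assms by (simp add: add.assoc E_add)
  ultimately have "homoclinic (X + E 0 w1) (E 0 (w2 - w1))"
    using assms homoclinic_exists Eu_cone by simp
  then obtain n u t M \<epsilon> where h: "0 < u" "u < 1" "linear M" "0 < \<epsilon>" "\<bar>t\<bar> < \<tau>" "cu (M (E 0 (w2 - w1))) \<noteq> 0"
    "\<And>v. norm v < \<epsilon> \<Longrightarrow> (f ^^ n) (X + E 0 w1 + u *\<^sub>R E 0 (w2 - w1) + v) = X + E t 0 + M v"
    using homoclinic_near_X[OF _ assms(5)] by metis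
  define w where "w = w1 + u * (w2 - w1)"
  have w: "X + E 0 w1 + u *\<^sub>R E 0 (w2 - w1) = X + E 0 w" by (simp add: w_def E_scale E_add add.assoc)
  have "w1 < w" using assms h(1) by (simp add: w_def)
  moreover have "w < w2"
  proof -
    have "u * (w2 - w1) < 1 * (w2 - w1)" using assms h(2) by (intro mult_strict_right_mono) auto
    then show ?thesis by (simp add: w_def)
  qed
  moreover have "cu (M (E 0 1)) \<noteq> 0"
    using h(6) unfolding eD by (simp add: linear_scale[OF h(3)] linear_scale[OF linear_cu])
  ultimately show ?thesis
    using \<open>w1 < w\<close> h(3-5) h(7)[unfolded w]
    by (intro exI[of _ n] exI[of _ w] exI[of _ t] exI[of _ M] exI[of _ \<epsilon>] conjI allI impI)
qed

text \<open>An inclination lemma: after the homoclinic excursion the piece crosses the stable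
  segment transversally, and \<open>k\<close> further steps contract its stable coordinate by
  \<open>r^k\<close> and stretch the unstable one by \<open>b^k\<close>. The time does not depend on
  \<open>w\<close>, so one \<open>n\<close> serves several targets.\<close>

lemma unstable_segment_spreads:
  assumes \<eta>: "\<eta> < xX / 4" "\<forall>c. \<bar>c\<bar> \<le> \<eta> \<longrightarrow> X + E 0 c \<in> trap"
    and w: "- \<eta> \<le> w1" "w1 < w2" "w2 \<le> \<eta>" and e: "0 < e"
  shows "\<forall>\<^sub>F n in sequentially. \<forall>w. \<bar>w\<bar> \<le> \<eta> \<longrightarrow>
     (\<exists>c. w1 < c \<and> c < w2 \<and> dist ((f ^^ n) (X + E 0 c)) (X + E 0 w) < e)"
proof -
  have quarter: "0 < xX / 4" using xX_pos by simp
  obtain n w0 t M \<epsilon> where h: "w1 < w0" "w0 < w2" "linear M" "0 < \<epsilon>" "\<bar>t\<bar> < xX / 4"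
      "cu (M (E 0 1)) \<noteq> 0" "\<And>v. norm v < \<epsilon> \<Longrightarrow> (f ^^ n) (X + E 0 w0 + v) = X + E t 0 + M v"
    using unstable_segment_homoclinic[OF \<eta>(2) w quarter] by blast
  define \<mu>s \<mu>u where "\<mu>s = cs (M (E 0 1))" and "\<mu>u = cu (M (E 0 1))"
  have \<mu>u: "\<mu>u \<noteq> 0" using h by (simp add: \<mu>u_def)
  have ME: "M (E 0 c) = E (c * \<mu>s) (c * \<mu>u)" for c
  proof -
    have "M (E 0 c) = c *\<^sub>R M (E 0 1)" by (simp flip: linear_scale[OF h(3)] add: E_scale)
    also have "\<dots> = c *\<^sub>R E \<mu>s \<mu>u" by (simp add: \<mu>s_def \<mu>u_def E_cs_cu)
    finally show ?thesis by (simp add: E_scale)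
  qed
  define Ns Nu where "Ns = norm (E 1 0)" and "Nu = norm (E 0 1)"
  \<comment> \<open>A bound for the offset from \<open>w0\<close> that \<open>k\<close> further
    steps stretch to unstable length at most \<open>\<eta>\<close>.\<close>
  define \<beta> where "\<beta> k = \<eta> / \<bar>\<mu>u\<bar> * inverse b ^ k" for k
  have \<beta>0: "\<beta> \<longlonglongrightarrow> 0" unfolding \<beta>_def
    using b1 by (intro tendsto_mult_right_zero LIMSEQ_power_zero) (auto simp: inverse_eq_divide)
  have r_lim: "(\<lambda>k. r ^ k) \<longlonglongrightarrow> 0" using r0 r1 by (intro LIMSEQ_power_zero) auto
  have "\<forall>\<^sub>F k in sequentially. Nu * \<beta> k < \<epsilon> \<and> \<beta> k < w0 - w1 \<and> \<beta> k < w2 - w0 \<and>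
      \<bar>t\<bar> + \<beta> k * \<bar>\<mu>s\<bar> < xX / 2 \<and> Ns * (r ^ k * (xX / 2)) < e"
  proof (intro eventually_conj)
    have "(\<lambda>k. Nu * \<beta> k) \<longlonglongrightarrow> Nu * 0" by (intro tendsto_intros \<beta>0)
    then show "\<forall>\<^sub>F k in sequentially. Nu * \<beta> k < \<epsilon>" using h by (intro order_tendstoD(2)) auto
    show "\<forall>\<^sub>F k in sequentially. \<beta> k < w0 - w1" "\<forall>\<^sub>F k in sequentially. \<beta> k < w2 - w0"
      using h by (auto intro: order_tendstoD(2)[OF \<beta>0])
    have "(\<lambda>k. \<bar>t\<bar> + \<beta> k * \<bar>\<mu>s\<bar>) \<longlonglongrightarrow> \<bar>t\<bar> + 0 * \<bar>\<mu>s\<bar>" by (intro tendsto_intros \<beta>0)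
    then show "\<forall>\<^sub>F k in sequentially. \<bar>t\<bar> + \<beta> k * \<bar>\<mu>s\<bar> < xX / 2"
      using h xX_pos by (intro order_tendstoD(2)) auto
    have "(\<lambda>k. Ns * (r ^ k * (xX / 2))) \<longlonglongrightarrow> Ns * (0 * (xX / 2))" by (intro tendsto_intros r_lim)
    then show "\<forall>\<^sub>F k in sequentially. Ns * (r ^ k * (xX / 2)) < e" using e by (intro order_tendstoD(2)) auto
  qed
  then have "\<forall>\<^sub>F k in sequentially. \<forall>w. \<bar>w\<bar> \<le> \<eta> \<longrightarrow>
     (\<exists>c. w1 < c \<and> c < w2 \<and> dist ((f ^^ (k + n)) (X + E 0 c)) (X + E 0 w) < e)"
  proof (rule eventually_mono, intro allI impI)
    fix k w
    assume k: "Nu * \<beta> k < \<epsilon> \<and> \<beta> k < w0 - w1 \<and> \<beta> k < w2 - w0 \<and>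
      \<bar>t\<bar> + \<beta> k * \<bar>\<mu>s\<bar> < xX / 2 \<and> Ns * (r ^ k * (xX / 2)) < e" and wb: "\<bar>w\<bar> \<le> \<eta>"
    \<comment> \<open>The unstable coordinate of this offset arrives exactly at
      \<open>w\<close>.\<close>
    define c where "c = w / ((- b) ^ k * \<mu>u)"
    have bk: "(- b) ^ k * (c * \<mu>u) = w" "b ^ k * \<bar>c * \<mu>u\<bar> = \<bar>w\<bar>"
      using \<mu>u b1 by (auto simp: c_def abs_mult power_abs)
    have "\<bar>c\<bar> = \<bar>w\<bar> / \<bar>\<mu>u\<bar> * inverse b ^ k"
      using b1 by (simp add: c_def abs_mult power_abs divide_simps)
    also have "\<dots> \<le> \<beta> k" unfolding \<beta>_def using wb b1 by (intro mult_right_mono divide_right_mono) auto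
    finally have c: "\<bar>c\<bar> \<le> \<beta> k" .
    have "norm (E 0 c) \<le> Nu * \<bar>c\<bar>" using norm_E_le[of 0 c] by (simp add: Nu_def)
    also have "\<dots> \<le> Nu * \<beta> k" using c by (intro mult_left_mono) (auto simp: Nu_def)
    finally have "norm (E 0 c) < \<epsilon>" using k by simp
    then have "(f ^^ n) (X + E 0 (w0 + c)) = X + E t 0 + M (E 0 c)"
      using h(7)[of "E 0 c"] E_add[of 0 w0 0 c] by (simp add: add.assoc)
    then have fn: "(f ^^ n) (X + E 0 (w0 + c)) = X + E (t + c * \<mu>s) (c * \<mu>u)"
      by (simp add: ME E_add add.assoc)
    have "\<bar>c * \<mu>s\<bar> \<le> \<beta> k * \<bar>\<mu>s\<bar>" using c by (simp add: abs_mult mult_right_mono)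
    then have ts: "\<bar>t + c * \<mu>s\<bar> < xX / 2" using k by linarith
    then have "\<bar>t + c * \<mu>s\<bar> + b ^ k * \<bar>c * \<mu>u\<bar> < xX" using bk wb \<eta> xX_pos by linarith
    from funpow_near_X[OF this]
    have "(f ^^ (k + n)) (X + E 0 (w0 + c)) = X + E ((- r) ^ k * (t + c * \<mu>s)) w"
      by (simp add: funpow_add fn bk)
    also have "\<dots> = (X + E 0 w) + E ((- r) ^ k * (t + c * \<mu>s)) 0"
      by (simp add: E_add add.assoc)
    finally have "dist ((f ^^ (k + n)) (X + E 0 (w0 + c))) (X + E 0 w) = norm (E ((- r) ^ k * (t + c * \<mu>s)) 0)"
      by (simp add: dist_norm)
    also have "\<dots> \<le> Ns * (r ^ k * \<bar>t + c * \<mu>s\<bar>)"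
      using norm_E_le[of "(- r) ^ k * (t + c * \<mu>s)" 0] r0 by (simp add: Ns_def abs_mult power_abs)
    also have "\<dots> \<le> Ns * (r ^ k * (xX / 2))"
      using ts r0 by (intro mult_left_mono) (auto simp: Ns_def)
    also have "\<dots> < e" using k by simp
    finally have d: "dist ((f ^^ (k + n)) (X + E 0 (w0 + c))) (X + E 0 w) < e" .
    have "w1 < w0 + c" "w0 + c < w2" using c k by linarith+
    then show "\<exists>c. w1 < c \<and> c < w2 \<and> dist ((f ^^ (k + n)) (X + E 0 c)) (X + E 0 w) < e"
      using d by blast
  qed
  then show ?thesis by (rule eventually_sequentially_seg[THEN iffD1])
qed

subsection \<open>The unstable manifold\<close>

definition Wf :: "(real \<times> real) set" where
  "Wf = {P. ((\<lambda>n. (inv f ^^ n) P) \<longlongrightarrow> X) sequentially}"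

lemma inv_f_f [simp]: "inv f (f P) = P" and f_inv_f [simp]: "f (inv f P) = P"
  using bij_f by (simp_all add: bij_is_inj bij_is_surj surj_f_inv_f)

lemma funpow_inv_f: "(f ^^ n) ((inv f ^^ n) P) = P" "(inv f ^^ n) ((f ^^ n) P) = P"
  by (induction n arbitrary: P) (simp_all add: funpow_swap1)

lemma Wf_funpow: 
  assumes "P \<in> Wf" shows "(f ^^ j) P \<in> Wf"
proof -
  have "(\<lambda>n. (inv f ^^ (n + j)) ((f ^^ j) P)) \<longlonglongrightarrow> X"
    using assms by (simp add: Wf_def funpow_add funpow_inv_f)
  then have "(\<lambda>n. (inv f ^^ n) ((f ^^ j) P)) \<longlonglongrightarrow> X" by (rule LIMSEQ_offset)
  then show ?thesis by (simp add: Wf_def)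
qed

text \<open>Backwards, the unstable coordinate is divided by \<open>- b\<close>, so the orbit stays
  on the right and tends to \<open>X\<close>.\<close>

lemma local_unstable_subset: 
  assumes "\<bar>c\<bar> < xX" shows "X + E 0 c \<in> Wf"
proof -
  have "(inv f ^^ n) (X + E 0 c) = X + E 0 (c * (- (1 / b)) ^ n)" for n
  proof (induction n)
    case (Suc n)
    define d where "d = c * (- (1 / b)) ^ n"
    have "\<bar>d / b\<bar> \<le> \<bar>c\<bar>"
    proof -
      have "\<bar>- (1 / b)\<bar> ^ n \<le> 1" using b1 by (intro power_le_one) auto
      then have "\<bar>d\<bar> \<le> \<bar>c\<bar> * 1" unfolding d_def abs_mult power_abs by (intro mult_left_mono) auto
      moreover have "\<bar>d / b\<bar> \<le> \<bar>d\<bar> / 1" unfolding abs_divide using b1 by (intro divide_left_mono) auto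
      ultimately show ?thesis by simp
    qed
    then have "- xX \<le> 0 + - (d / b)" using assms by linarith
    from f_near_X[OF this] have "f (X + E 0 (- (d / b))) = X + E 0 d" using b1 by simp
    then have "inv f (X + E 0 d) = X + E 0 (- (d / b))" by (metis inv_f_f)
    then show ?case using Suc by (simp add: d_def)
  qed simp
  moreover have "(\<lambda>n. X + E 0 (c * (- (1 / b)) ^ n)) \<longlonglongrightarrow> X + E 0 (c * 0)"
    unfolding E_def using b1 by (intro tendsto_intros LIMSEQ_power_zero) auto
  ultimately show ?thesis by (simp add: Wf_def E_def zero_prod_def[symmetric])
qed

text \<open>A backward orbit tending to \<open>X\<close> is eventually on the right, where each
  backward step multiplies the size of its stable coordinate by \<open>1 / r\<close>. Convergence
  forces that coordinate to vanish, so the orbit has entered the local unstable line.\<close>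

lemma Wf_iff:
  assumes "0 < \<eta>" "\<eta> < xX"
  shows "P \<in> Wf \<longleftrightarrow> (\<exists>j c. \<bar>c\<bar> < \<eta> \<and> P = (f ^^ j) (X + E 0 c))"
proof
  assume "\<exists>j c. \<bar>c\<bar> < \<eta> \<and> P = (f ^^ j) (X + E 0 c)"
  then obtain j c where "\<bar>c\<bar> < \<eta>" "P = (f ^^ j) (X + E 0 c)" by blast
  then show "P \<in> Wf" using Wf_funpow local_unstable_subset assms by simp
next
  assume "P \<in> Wf"
  then have lim: "(\<lambda>n. (inv f ^^ n) P) \<longlonglongrightarrow> X" by (simp add: Wf_def)
  define R where "R n = (inv f ^^ n) P - X" for n
  have R0: "R \<longlonglongrightarrow> 0" unfolding R_def using tendsto_diff[OF lim tendsto_const[of X]] by simp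
  have fR: "(\<lambda>n. fst (R n)) \<longlonglongrightarrow> 0" using tendsto_fst[OF R0] by simp
  have sR: "(\<lambda>n. snd (R n)) \<longlonglongrightarrow> 0" using tendsto_snd[OF R0] by simp
  have csR: "(\<lambda>n. cs (R n)) \<longlonglongrightarrow> (0 - r * 0) / (b - r)"
    and cuR: "(\<lambda>n. cu (R n)) \<longlonglongrightarrow> (b * 0 - 0) / (b - r)"
    unfolding cs_def cu_def using br by (intro tendsto_intros fR sR, simp)+
  have "\<forall>\<^sub>F n in sequentially. - xX < fst (R n) \<and> - \<eta> < cu (R n) \<and> cu (R n) < \<eta>"
    using assms xX_pos
    by (intro eventually_conj order_tendstoD(1)[OF fR] order_tendstoD[OF cuR]) auto
  then obtain N where N: "\<And>n. n \<ge> N \<Longrightarrow> - xX < fst (R n) \<and> \<bar>cu (R n)\<bar> < \<eta>"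
    unfolding eventually_sequentially by (metis abs_less_iff minus_less_iff)
  have step: "cs (R n) = - r * cs (R (Suc n))" if "n \<ge> N" for n
  proof -
    have "fst (R (Suc n)) = cs (R (Suc n)) + cu (R (Suc n))"
      by (subst E_cs_cu[of "R (Suc n)", symmetric]) (simp add: E_def)
    then have "- xX \<le> cs (R (Suc n)) + cu (R (Suc n))" using N[of "Suc n"] that by auto
    from f_near_X[OF this] have "f (X + R (Suc n)) = X + E (- r * cs (R (Suc n))) (- b * cu (R (Suc n)))"
      by (simp add: E_cs_cu)
    moreover have "f (X + R (Suc n)) = X + R n" by (simp add: R_def)
    ultimately show ?thesis by simp
  qed
  have "\<bar>cs (R N)\<bar> \<le> \<bar>cs (R (N + k))\<bar>" for k
  proof (induction k)
    case (Suc k)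
    have "\<bar>cs (R (N + k))\<bar> = r * \<bar>cs (R (N + Suc k))\<bar>"
      using step[of "N + k"] r0 by (simp add: abs_mult)
    also have "\<dots> \<le> \<bar>cs (R (N + Suc k))\<bar>" using r0 r1 by (simp add: mult_left_le_one_le)
    finally show ?case using Suc by linarith
  qed simp
  moreover have "(\<lambda>k. \<bar>cs (R (N + k))\<bar>) \<longlonglongrightarrow> 0"
    using LIMSEQ_ignore_initial_segment[OF tendsto_rabs[OF csR], of N] by (simp add: add.commute)
  ultimately have "\<bar>cs (R N)\<bar> \<le> 0" by (intro LIMSEQ_le_const) auto
  then have "R N = E 0 (cu (R N))" using E_cs_cu[of "R N"] by simp
  then have "(inv f ^^ N) P = X + E 0 (cu (R N))" by (metis R_def add_diff_cancel_left' diff_add_cancel add.commute)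
  then have "P = (f ^^ N) (X + E 0 (cu (R N)))" using funpow_inv_f(1) by metis
  then show "\<exists>j c. \<bar>c\<bar> < \<eta> \<and> P = (f ^^ j) (X + E 0 c)" using N by blast
qed

lemma closure_Wf_funpow: "P \<in> closure Wf \<Longrightarrow> (f ^^ j) P \<in> closure Wf"
proof -
  have "(f ^^ j) ` closure Wf \<subseteq> closure Wf"
    by (rule image_closure_subset)
      (use Wf_funpow closure_subset continuous_on_subset[OF continuous_funpow] in \<open>blast+\<close>)
  then show "P \<in> closure Wf \<Longrightarrow> (f ^^ j) P \<in> closure Wf" by blast
qed

text \<open>Near the homoclinic point \<^term>\<open>X + E 0 w\<close> the return map \<^term>\<open>f ^^ (k + n)\<close> is affine, and for
  large \<^term>\<open>k\<close> it has a saddle fixed point \<^term>\<open>Q\<close> whose stable direction \<^term>\<open>E 1 \<sigma>\<close> is transverse to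
  the local unstable manifold of \<^term>\<open>X\<close>. The point \<^term>\<open>Q - E vs (vs * \<sigma>)\<close> lies in the latter
  and is attracted to \<^term>\<open>Q\<close>, which puts \<^term>\<open>Q\<close> into the closure of \<^term>\<open>Wf\<close>.\<close>

lemma homoclinic_imp_periodic:
  assumes M: "linear M" "cu (M (E 0 1)) \<noteq> 0" and \<epsilon>: "0 < \<epsilon>"
    and t: "\<bar>t\<bar> < xX / 4" and w: "\<bar>w\<bar> < xX / 4"
    and fn: "\<forall>v. norm v < \<epsilon> \<longrightarrow> (f ^^ n) (X + E 0 w + v) = X + E t 0 + M v"
    and e: "0 < e"
  shows "\<exists>Q N. dist Q (X + E 0 w) < e \<and> 0 < N \<and> (f ^^ N) Q = Q \<and> Q \<in> closure Wf"
proof -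
  define ss us su uu where "ss = cs (M (E 1 0))" and "us = cu (M (E 1 0))"
    and "su = cs (M (E 0 1))" and "uu = cu (M (E 0 1))"
  have uu: "uu \<noteq> 0" using M by (simp add: uu_def)
  have ME: "M (E c d) = E (ss * c + su * d) (us * c + uu * d)" for c d
  proof -
    have "M (E c d) = M (c *\<^sub>R E 1 0 + d *\<^sub>R E 0 1)" by (simp add: E_scale E_add)
    also have "\<dots> = c *\<^sub>R E ss us + d *\<^sub>R E su uu"
      by (simp add: linear_add[OF M(1)] linear_scale[OF M(1)] ss_def us_def su_def uu_def E_cs_cu)
    finally show ?thesis by (simp add: E_scale E_add mult.commute)
  qed
  define \<rho> \<kappa> where "\<rho> k = (- r) ^ k" and "\<kappa> k = (- (1 / b)) ^ k" for k
  have \<rho>: "\<rho> \<longlonglongrightarrow> 0" and \<kappa>: "\<kappa> \<longlonglongrightarrow> 0"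
    unfolding \<rho>_def \<kappa>_def using r0 r1 b1 by (auto intro!: LIMSEQ_power_zero)
  have \<kappa>b: "(- b) ^ k * \<kappa> k = 1" "b ^ k * \<bar>\<kappa> k\<bar> = 1" for k
    using b1 by (simp_all add: \<kappa>_def power_abs flip: power_mult_distrib)
  \<comment> \<open>Cramer's rule for \<open>eq_s\<close> and \<open>eq_u\<close>, the equations
    making \<open>E (vs k) (vu k)\<close> the displacement of \<open>Q\<close> from the homoclinic
    point. The determinant tends to \<open>uu \<noteq> 0\<close>.\<close>
  define det where "det k = (1 - \<rho> k * ss) * (uu - \<kappa> k) + \<rho> k * su * us" for k
  define vs vu where "vs k = (\<rho> k * t * (uu - \<kappa> k) + \<rho> k * su * \<kappa> k * w) / det k"
    and "vu k = ((1 - \<rho> k * ss) * \<kappa> k * w - us * \<rho> k * t) / det k" for k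
  have "det \<longlonglongrightarrow> (1 - 0 * ss) * (uu - 0) + 0 * su * us"
    unfolding det_def by (intro tendsto_intros \<rho> \<kappa>)
  then have det: "det \<longlonglongrightarrow> uu" by simp
  have "vs \<longlonglongrightarrow> (0 * t * (uu - 0) + 0 * su * 0 * w) / uu"
    unfolding vs_def using uu by (intro tendsto_intros \<rho> \<kappa> det) auto
  then have vs: "vs \<longlonglongrightarrow> 0" by simp
  have "vu \<longlonglongrightarrow> ((1 - 0 * ss) * 0 * w - us * 0 * t) / uu"
    unfolding vu_def using uu by (intro tendsto_intros \<rho> \<kappa> det) auto
  then have vu: "vu \<longlonglongrightarrow> 0" by simp
  define S where "S = \<bar>us / uu\<bar> + 1"
  have S: "1 \<le> S" by (simp add: S_def)
  define L where "L = (\<bar>ss\<bar> + \<bar>su\<bar> * S)"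
  have L: "0 \<le> L" using S by (simp add: L_def)
  define Ns Nu where "Ns = norm (E 1 0)" and "Nu = norm (E 0 1)"
  \<comment> \<open>\<open>G k\<close> keeps the stable segment of \<open>Q\<close> in the ball
    where the formula for \<open>f ^^ n\<close> holds; \<open>T k\<close> bounds the drift of the
    stable coordinate from \<open>t\<close>.\<close>
  define G where "G k = Ns * (2 * \<bar>vs k\<bar>) + Nu * (\<bar>vu k\<bar> + \<bar>vs k\<bar> * S)" for k
  define T where "T k = \<bar>ss\<bar> * (2 * \<bar>vs k\<bar>) + \<bar>su\<bar> * (\<bar>vu k\<bar> + \<bar>vs k\<bar> * S)" for k
  have G: "G \<longlonglongrightarrow> 0" and T: "T \<longlonglongrightarrow> 0"
  proof -
    have "G \<longlonglongrightarrow> Ns * (2 * \<bar>0\<bar>) + Nu * (\<bar>0\<bar> + \<bar>0\<bar> * S)"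
      unfolding G_def by (intro tendsto_intros vs vu)
    then show "G \<longlonglongrightarrow> 0" by simp
    have "T \<longlonglongrightarrow> \<bar>ss\<bar> * (2 * \<bar>0\<bar>) + \<bar>su\<bar> * (\<bar>0\<bar> + \<bar>0\<bar> * S)"
      unfolding T_def by (intro tendsto_intros vs vu)
    then show "T \<longlonglongrightarrow> 0" by simp
  qed
  have L\<rho>: "(\<lambda>k. \<bar>\<rho> k\<bar> * L) \<longlonglongrightarrow> 0" and L\<kappa>: "(\<lambda>k. \<bar>\<kappa> k * \<rho> k\<bar> * L * S) \<longlonglongrightarrow> 0"
  proof -
    have "(\<lambda>k. \<bar>\<rho> k\<bar> * L) \<longlonglongrightarrow> \<bar>0\<bar> * L" by (intro tendsto_intros \<rho>)
    then show "(\<lambda>k. \<bar>\<rho> k\<bar> * L) \<longlonglongrightarrow> 0" by simp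
    have "(\<lambda>k. \<bar>\<kappa> k * \<rho> k\<bar> * L * S) \<longlonglongrightarrow> \<bar>0 * 0\<bar> * L * S" by (intro tendsto_intros \<rho> \<kappa>)
    then show "(\<lambda>k. \<bar>\<kappa> k * \<rho> k\<bar> * L * S) \<longlonglongrightarrow> 0" by simp
  qed
  have VU: "(\<lambda>k. \<bar>vu k\<bar> + \<bar>vs k\<bar> * S) \<longlonglongrightarrow> 0"
  proof -
    have "(\<lambda>k. \<bar>vu k\<bar> + \<bar>vs k\<bar> * S) \<longlonglongrightarrow> \<bar>0\<bar> + \<bar>0\<bar> * S" by (intro tendsto_intros vs vu)
    then show ?thesis by simp
  qed
  have "\<forall>\<^sub>F k in sequentially. 0 < k \<and> G k < \<epsilon> \<and> G k < e \<and> T k < xX / 4 \<and> \<bar>\<rho> k\<bar> * L < 1 / 2 \<and>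
      \<bar>\<kappa> k * \<rho> k\<bar> * L * S < \<bar>uu\<bar> \<and> \<bar>vu k\<bar> + \<bar>vs k\<bar> * S < xX / 4 \<and> det k \<noteq> 0"
    using \<epsilon> e uu xX_pos
    by (intro eventually_conj eventually_gt_at_top order_tendstoD(2)[OF G] order_tendstoD(2)[OF T]
        order_tendstoD(2)[OF L\<rho>] order_tendstoD(2)[OF L\<kappa>] order_tendstoD(2)[OF VU]
        tendsto_imp_eventually_ne[OF det]) auto
  then obtain k where k: "0 < k" "G k < \<epsilon>" "G k < e" "T k < xX / 4" "\<bar>\<rho> k\<bar> * L < 1 / 2"
      "\<bar>\<kappa> k * \<rho> k\<bar> * L * S < \<bar>uu\<bar>" "\<bar>vu k\<bar> + \<bar>vs k\<bar> * S < xX / 4" "det k \<noteq> 0"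
    using eventually_happens by force
  have eq_s: "\<rho> k * (t + ss * vs k + su * vu k) = vs k"
  proof -
    have "(1 - \<rho> k * ss) * (vs k * det k) - \<rho> k * su * (vu k * det k) = \<rho> k * t * det k"
      using k(8) by (simp add: vs_def vu_def) (simp add: det_def algebra_simps)
    then have "((1 - \<rho> k * ss) * vs k - \<rho> k * su * vu k) * det k = \<rho> k * t * det k"
      by (simp add: algebra_simps)
    then have "(1 - \<rho> k * ss) * vs k - \<rho> k * su * vu k = \<rho> k * t" using k(8) by simp
    then show ?thesis by (simp add: algebra_simps)
  qed
  have eq_u: "us * vs k + uu * vu k = \<kappa> k * (w + vu k)"
  proof -
    have "us * (vs k * det k) + (uu - \<kappa> k) * (vu k * det k) = \<kappa> k * w * det k"
      using k(8) by (simp add: vs_def vu_def) (simp add: det_def algebra_simps)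
    then have "(us * vs k + (uu - \<kappa> k) * vu k) * det k = \<kappa> k * w * det k"
      by (simp add: algebra_simps)
    then have "us * vs k + (uu - \<kappa> k) * vu k = \<kappa> k * w" using k(8) by simp
    then show ?thesis by (simp add: algebra_simps)
  qed
  \<comment> \<open>A zero of \<open>h\<close> is the slope of an invariant direction of the return
    map. As a small perturbation of \<open>us + uu * \<sigma>\<close>, \<open>h\<close> changes sign
    between the points at distance 1 from \<open>- us / uu\<close>.\<close>
  define h where "h \<sigma> = us + uu * \<sigma> - \<kappa> k * \<rho> k * (ss + su * \<sigma>) * \<sigma>" for \<sigma>
  have sl: "\<bar>ss + su * \<sigma>\<bar> \<le> L" if "\<bar>\<sigma>\<bar> \<le> S" for \<sigma>
  proof -
    have "\<bar>su * \<sigma>\<bar> \<le> \<bar>su\<bar> * S" using that by (simp add: abs_mult mult_left_mono)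
    then show ?thesis by (simp add: L_def)
  qed
  have small: "\<bar>\<kappa> k * \<rho> k * (ss + su * \<sigma>) * \<sigma>\<bar> < \<bar>uu\<bar>" if "\<bar>\<sigma>\<bar> \<le> S" for \<sigma>
  proof -
    have "\<bar>\<kappa> k * \<rho> k\<bar> * \<bar>ss + su * \<sigma>\<bar> * \<bar>\<sigma>\<bar> \<le> \<bar>\<kappa> k * \<rho> k\<bar> * L * S"
      using sl[OF that] that L by (intro mult_mono) auto
    then show ?thesis using k(6) by (simp add: abs_mult)
  qed
  obtain \<sigma> where \<sigma>: "\<bar>\<sigma>\<bar> \<le> S" "h \<sigma> = 0"
  proof -
    define l u where "l = - us / uu - 1" and "u = - us / uu + 1"
    have lu: "l \<le> u" "\<And>x. l \<le> x \<Longrightarrow> x \<le> u \<Longrightarrow> \<bar>x\<bar> \<le> S"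
      unfolding l_def u_def S_def minus_divide_left[symmetric] by linarith+
    have c: "continuous_on {l..u} h" unfolding h_def by (intro continuous_intros)
    have hl: "\<bar>h l + uu\<bar> < \<bar>uu\<bar>" "\<bar>h u - uu\<bar> < \<bar>uu\<bar>"
      using small[of l] small[of u] lu uu by (auto simp: h_def l_def u_def algebra_simps)
    then have "h l \<le> 0 \<and> 0 \<le> h u \<or> h u \<le> 0 \<and> 0 \<le> h l" by linarith
    then obtain x where "l \<le> x" "x \<le> u" "h x = 0"
      using IVT'[of h l 0 u] IVT2'[of h u 0 l] lu c by blast
    then show ?thesis using that lu by blast
  qed
  define \<nu> where "\<nu> = \<rho> k * (ss + su * \<sigma>)"
  have \<nu>: "\<bar>\<nu>\<bar> < 1 / 2"
  proof -
    have "\<bar>\<nu>\<bar> \<le> \<bar>\<rho> k\<bar> * L" unfolding \<nu>_def abs_mult using sl \<sigma> by (intro mult_left_mono) auto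
    then show ?thesis using k by simp
  qed
  have eq_\<sigma>: "us + uu * \<sigma> = \<kappa> k * \<nu> * \<sigma>" using \<sigma> by (simp add: h_def \<nu>_def mult_ac)
  define Q where "Q = X + E 0 w + E (vs k) (vu k)"
  \<comment> \<open>This range of \<open>c\<close> reaches \<open>c = - vs k\<close>, where the
    stable line of \<open>Q\<close> meets the local unstable line of \<open>X\<close>.\<close>
  have ret: "(f ^^ (k + n)) (Q + E c (c * \<sigma>)) = Q + E (\<nu> * c) (\<nu> * c * \<sigma>)" if c: "\<bar>c\<bar> \<le> \<bar>vs k\<bar>" for c
  proof -
    let ?d = "vu k + c * \<sigma>"
    have c\<sigma>: "\<bar>c * \<sigma>\<bar> \<le> \<bar>vs k\<bar> * S" unfolding abs_mult using c \<sigma> by (intro mult_mono) auto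
    have d: "\<bar>?d\<bar> \<le> \<bar>vu k\<bar> + \<bar>vs k\<bar> * S" using c\<sigma> by linarith
    have vc: "\<bar>vs k + c\<bar> \<le> 2 * \<bar>vs k\<bar>" using c by linarith
    have "norm (E (vs k + c) ?d) \<le> Ns * \<bar>vs k + c\<bar> + Nu * \<bar>?d\<bar>"
      using norm_E_le by (simp add: Ns_def Nu_def)
    also have "\<dots> \<le> G k" unfolding G_def using d vc
      by (intro add_mono mult_left_mono) (auto simp: Ns_def Nu_def)
    finally have "norm (E (vs k + c) ?d) < \<epsilon>" using k by simp
    then have "(f ^^ n) (X + E 0 w + E (vs k + c) ?d) = X + E t 0 + M (E (vs k + c) ?d)" by (rule fn[rule_format])
    moreover have "Q + E c (c * \<sigma>) = X + E 0 w + E (vs k + c) ?d" by (simp add: Q_def E_add add.assoc)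
    moreover have "us * (vs k + c) + uu * ?d = \<kappa> k * (w + vu k + \<nu> * c * \<sigma>)"
    proof -
      have "us * (vs k + c) + uu * ?d = (us * vs k + uu * vu k) + c * (us + uu * \<sigma>)"
        by (simp add: algebra_simps)
      then show ?thesis unfolding eq_u eq_\<sigma> by (simp add: algebra_simps)
    qed
    moreover have "X + E t 0 + E p q = X + E (t + p) q" for p q by (simp add: E_add add.assoc)
    ultimately have 1: "(f ^^ n) (Q + E c (c * \<sigma>))
        = X + E (t + (ss * (vs k + c) + su * ?d)) (\<kappa> k * (w + vu k + \<nu> * c * \<sigma>))"
      by (simp only: ME)
    have "\<bar>ss * (vs k + c)\<bar> \<le> \<bar>ss\<bar> * (2 * \<bar>vs k\<bar>)" "\<bar>su * ?d\<bar> \<le> \<bar>su\<bar> * (\<bar>vu k\<bar> + \<bar>vs k\<bar> * S)"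
      unfolding abs_mult using d vc by (auto intro: mult_left_mono)
    then have "\<bar>ss * (vs k + c)\<bar> + \<bar>su * ?d\<bar> \<le> T k" unfolding T_def by (rule add_mono)
    moreover have "\<bar>t + (p + q)\<bar> \<le> \<bar>t\<bar> + (\<bar>p\<bar> + \<bar>q\<bar>)" for p q by linarith
    ultimately have "\<bar>t + (ss * (vs k + c) + su * ?d)\<bar> \<le> \<bar>t\<bar> + T k"
      by (meson add_left_mono order_trans)
    then have 2: "\<bar>t + (ss * (vs k + c) + su * ?d)\<bar> < xX / 2" using k(4) t by linarith
    have "\<bar>\<nu> * (c * \<sigma>)\<bar> \<le> 1 * \<bar>c * \<sigma>\<bar>" unfolding abs_mult[of \<nu>] using \<nu> by (intro mult_right_mono) auto
    have 3: "\<bar>w + vu k + \<nu> * c * \<sigma>\<bar> < xX / 2"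
    proof -
      have "\<bar>w + p + q\<bar> < xX / 2" if "\<bar>q\<bar> \<le> m" "m \<le> n" "\<bar>p\<bar> + n < xX / 4" for p q m n
        using that w by linarith
      then show ?thesis using \<open>\<bar>\<nu> * (c * \<sigma>)\<bar> \<le> 1 * \<bar>c * \<sigma>\<bar>\<close> c\<sigma> k(7)
        unfolding mult.assoc mult_1 by blast
    qed
    have "b ^ k * \<bar>\<kappa> k * x\<bar> = \<bar>x\<bar>" for x
      using \<kappa>b(2)[of k] by (simp only: abs_mult mult.assoc[symmetric] mult_1)
    with 3 have "b ^ k * \<bar>\<kappa> k * (w + vu k + \<nu> * c * \<sigma>)\<bar> < xX / 2" by simp
    from add_strict_mono[OF 2 this]
    have "\<bar>t + (ss * (vs k + c) + su * ?d)\<bar> + b ^ k * \<bar>\<kappa> k * (w + vu k + \<nu> * c * \<sigma>)\<bar> < xX"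
      by (simp only: field_sum_of_halves)
    from funpow_near_X[OF this]
    have "(f ^^ (k + n)) (Q + E c (c * \<sigma>)) =
        X + E (\<rho> k * (t + (ss * (vs k + c) + su * ?d))) ((- b) ^ k * \<kappa> k * (w + vu k + \<nu> * c * \<sigma>))"
      unfolding funpow_add comp_apply 1 \<rho>_def by (simp only: mult.assoc)
    moreover have "\<rho> k * (t + (ss * (vs k + c) + su * ?d)) = \<rho> k * (t + ss * vs k + su * vu k) + \<nu> * c"
      by (simp add: \<nu>_def algebra_simps)
    ultimately have "(f ^^ (k + n)) (Q + E c (c * \<sigma>)) = X + E (vs k + \<nu> * c) (w + vu k + \<nu> * c * \<sigma>)"
      by (simp only: \<kappa>b eq_s mult_1)
    then show ?thesis by (simp add: Q_def E_add add.assoc)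
  qed
  have iter: "(f ^^ ((k + n) * j)) (Q + E c (c * \<sigma>)) = Q + E (\<nu> ^ j * c) (\<nu> ^ j * c * \<sigma>)" if c: "\<bar>c\<bar> \<le> \<bar>vs k\<bar>" for c j
  proof (induction j)
    case (Suc j)
    have "\<bar>\<nu> ^ j * c\<bar> \<le> \<bar>c\<bar>" unfolding abs_mult power_abs using \<nu>
      by (simp add: mult_left_le_one_le power_le_one)
    then have "(f ^^ (k + n)) (Q + E (\<nu> ^ j * c) (\<nu> ^ j * c * \<sigma>)) = Q + E (\<nu> * (\<nu> ^ j * c)) (\<nu> * (\<nu> ^ j * c) * \<sigma>)"
      using c by (intro ret) simp
    then show ?case using Suc by (simp add: funpow_add mult.assoc)
  qed simp
  have "norm (E (vs k) (vu k)) \<le> Ns * \<bar>vs k\<bar> + Nu * \<bar>vu k\<bar>"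
    using norm_E_le by (simp add: Ns_def Nu_def)
  also have "\<dots> \<le> G k" unfolding G_def using S
    by (intro add_mono mult_left_mono) (auto simp: Ns_def Nu_def)
  finally have near: "dist Q (X + E 0 w) < e" using k by (simp add: Q_def dist_norm)
  have fix_Q: "(f ^^ (k + n)) Q = Q" using ret[of 0] by (simp add: E_def zero_prod_def[symmetric])
  define P where "P = Q + E (- vs k) (- vs k * \<sigma>)"
  have "\<bar>vs k * \<sigma>\<bar> \<le> \<bar>vs k\<bar> * S" unfolding abs_mult using \<sigma> by (intro mult_left_mono) auto
  then have "\<bar>w + vu k - vs k * \<sigma>\<bar> < xX" using w k(7) xX_pos by linarith
  moreover have "P = X + E 0 (w + vu k - vs k * \<sigma>)" by (simp add: P_def Q_def E_add add.assoc)
  ultimately have "P \<in> Wf" using local_unstable_subset by simp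
  then have "(f ^^ ((k + n) * j)) P \<in> Wf" for j by (rule Wf_funpow)
  moreover have "(\<lambda>j. (f ^^ ((k + n) * j)) P) \<longlonglongrightarrow> Q"
  proof -
    have "(\<lambda>j. Q + E (\<nu> ^ j * (- vs k)) (\<nu> ^ j * (- vs k) * \<sigma>)) \<longlonglongrightarrow> Q + E (0 * (- vs k)) (0 * (- vs k) * \<sigma>)"
      unfolding E_def using \<nu> by (intro tendsto_intros LIMSEQ_power_zero) auto
    moreover have "Q + E (0 * (- vs k)) (0 * (- vs k) * \<sigma>) = Q" by (simp add: E_def zero_prod_def[symmetric])
    moreover have "(f ^^ ((k + n) * j)) P = Q + E (\<nu> ^ j * (- vs k)) (\<nu> ^ j * (- vs k) * \<sigma>)" for j
      unfolding P_def by (rule iter) simp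
    ultimately show ?thesis by (simp only:)
  qed
  ultimately have "Q \<in> closure Wf" unfolding closure_sequential
    by (intro exI[of _ "\<lambda>j. (f ^^ ((k + n) * j)) P"] conjI allI)
  then show ?thesis using near fix_Q k(1) by (intro exI[of _ Q] exI[of _ "k + n"]) simp
qed

subsection \<open>Devaney chaos\<close>

text \<open>Images of the local unstable segment sweep out the manifold, so by continuity the open
  set contains the image of a whole piece. All three properties of chaos reduce to such
  pieces.\<close>

lemma open_meets_closure_Wf:
  assumes \<eta>: "0 < \<eta>" "\<eta> < xX" and T: "open T" "p \<in> T" "p \<in> closure Wf"
  shows "\<exists>j w1 w2. - \<eta> \<le> w1 \<and> w1 < w2 \<and> w2 \<le> \<eta> \<and> (\<forall>c. w1 < c \<and> c < w2 \<longrightarrow> (f ^^ j) (X + E 0 c) \<in> T)"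
proof -
  obtain q where q: "q \<in> Wf" "q \<in> T" using T open_Int_closure_eq_empty[OF T(1), of Wf] by blast
  then obtain j c where c: "\<bar>c\<bar> < \<eta>" "q = (f ^^ j) (X + E 0 c)" using Wf_iff[OF \<eta>] by blast
  have "continuous_on UNIV (\<lambda>c. X + E 0 c)" unfolding E_def by (intro continuous_intros)
  then have "continuous_on UNIV ((f ^^ j) \<circ> (\<lambda>c. X + E 0 c))"
    by (rule continuous_on_compose) (rule continuous_on_subset[OF continuous_funpow], simp)
  then have "open (((f ^^ j) \<circ> (\<lambda>c. X + E 0 c)) -` T)" using T(1) by (simp add: open_vimage)
  moreover have "c \<in> ((f ^^ j) \<circ> (\<lambda>c. X + E 0 c)) -` T" using c q by simp
  ultimately obtain d where d: "0 < d" "ball c d \<subseteq> ((f ^^ j) \<circ> (\<lambda>c. X + E 0 c)) -` T"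
    by (meson openE)
  have "(f ^^ j) (X + E 0 c') \<in> T" if "max (c - d) (- \<eta>) < c'" "c' < min (c + d) \<eta>" for c'
    using that subsetD[OF d(2), of c'] by (simp add: dist_real_def abs_less_iff)
  then show ?thesis using c d
    by (intro exI[of _ j] exI[of _ "max (c - d) (- \<eta>)"] exI[of _ "min (c + d) \<eta>"]) auto
qed

lemma open_vimage_funpow: "open T \<Longrightarrow> open ((f ^^ j) -` T)"
  by (rule open_vimage[OF _ continuous_funpow])

lemma transitive: "top_transitive_on f (closure Wf)"
  unfolding top_transitive_on_def
proof (intro allI impI)
  fix U V
  assume UV: "openin (top_of_set (closure Wf)) U \<and> openin (top_of_set (closure Wf)) V \<and> U \<noteq> {} \<and> V \<noteq> {}"
  obtain T1 T2 where T: "open T1" "U = closure Wf \<inter> T1" "open T2" "V = closure Wf \<inter> T2"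
    using UV by (auto simp: openin_open)
  obtain \<eta> where \<eta>: "0 < \<eta>" "\<eta> < xX / 4" "\<forall>c. \<bar>c\<bar> \<le> \<eta> \<longrightarrow> X + E 0 c \<in> trap"
    using local_unstable_in_trap by blast
  then have \<eta>': "\<eta> < xX" using xX_pos by simp
  obtain p q where "p \<in> T1" "p \<in> closure Wf" "q \<in> T2" "q \<in> closure Wf" using UV T by auto
  then obtain i w1 w2 j v1 v2
    where w: "- \<eta> \<le> w1" "w1 < w2" "w2 \<le> \<eta>" "\<forall>c. w1 < c \<and> c < w2 \<longrightarrow> (f ^^ i) (X + E 0 c) \<in> T1"
    and v: "- \<eta> \<le> v1" "v1 < v2" "v2 \<le> \<eta>" "\<forall>c. v1 < c \<and> c < v2 \<longrightarrow> (f ^^ j) (X + E 0 c) \<in> T2"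
    using open_meets_closure_Wf[OF \<eta>(1) \<eta>' T(1)] open_meets_closure_Wf[OF \<eta>(1) \<eta>' T(3)] by blast
  define v where "v = (v1 + v2) / 2"
  have "X + E 0 v \<in> (f ^^ j) -` T2" using v by (simp add: v_def)
  then obtain e where e: "0 < e" "ball (X + E 0 v) e \<subseteq> (f ^^ j) -` T2"
    using open_vimage_funpow[OF T(3)] by (meson openE)
  \<comment> \<open>Asking for \<open>i < n\<close> makes the transition time
    \<open>j + (n - i)\<close> positive.\<close>
  have "\<forall>\<^sub>F n in sequentially. i < n \<and> (\<exists>c. w1 < c \<and> c < w2 \<and> dist ((f ^^ n) (X + E 0 c)) (X + E 0 v) < e)"
    using eventually_conj[OF eventually_gt_at_top[of i] unstable_segment_spreads[OF \<eta>(2,3) w(1-3) e(1)]]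
  proof (rule eventually_mono)
    have "\<bar>v\<bar> \<le> \<eta>" unfolding v_def using v(1-3) by (intro abs_leI) (simp_all add: field_simps)
    then show "i < n \<and> (\<exists>c. w1 < c \<and> c < w2 \<and> dist ((f ^^ n) (X + E 0 c)) (X + E 0 v) < e)"
      if "i < n \<and> (\<forall>w. \<bar>w\<bar> \<le> \<eta> \<longrightarrow> (\<exists>c. w1 < c \<and> c < w2 \<and> dist ((f ^^ n) (X + E 0 c)) (X + E 0 w) < e))" for n
      using that by blast
  qed
  then obtain n c where n: "i < n" "w1 < c" "c < w2" "dist ((f ^^ n) (X + E 0 c)) (X + E 0 v) < e"
    using eventually_happens'[OF sequentially_bot] by blast
  define P where "P = (f ^^ i) (X + E 0 c)"
  have P: "P \<in> Wf" unfolding P_def using n w \<eta>' by (intro Wf_funpow local_unstable_subset) auto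
  then have "P \<in> U" using T(2) w(4) n(2,3) closure_subset by (auto simp: P_def)
  have "(f ^^ n) (X + E 0 c) = (f ^^ (n - i)) P"
    unfolding P_def using n(1) by (simp flip: funpow_add[THEN fun_cong, unfolded comp_apply])
  then have "(f ^^ (j + (n - i))) P \<in> T2"
    using n(4) subsetD[OF e(2), of "(f ^^ (n - i)) P"] by (simp add: funpow_add dist_commute)
  moreover have "(f ^^ (j + (n - i))) P \<in> closure Wf" using Wf_funpow[OF P] closure_subset by blast
  ultimately have "(f ^^ (j + (n - i))) P \<in> (f ^^ (j + (n - i))) ` U \<inter> V" using \<open>P \<in> U\<close> T by blast
  then show "\<exists>n>0. (f ^^ n) ` U \<inter> V \<noteq> {}" using n(1) by (intro exI[of _ "j + (n - i)"]) auto
qed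

lemma periodic_dense: "periodic_dense_on f (closure Wf)"
  unfolding periodic_dense_on_def
proof
  fix p assume p: "p \<in> closure Wf"
  obtain \<eta> where \<eta>: "0 < \<eta>" "\<eta> < xX / 4" "\<forall>c. \<bar>c\<bar> \<le> \<eta> \<longrightarrow> X + E 0 c \<in> trap"
    using local_unstable_in_trap by blast
  then have \<eta>': "\<eta> < xX" and quarter: "0 < xX / 4" using xX_pos by auto
  let ?Per = "{P \<in> closure Wf. \<exists>n>0. (f ^^ n) P = P}"
  have "?Per \<inter> T \<noteq> {}" if T: "p \<in> T" "open T" for T
  proof -
    obtain j w1 w2 where w: "- \<eta> \<le> w1" "w1 < w2" "w2 \<le> \<eta>"
      "\<forall>c. w1 < c \<and> c < w2 \<longrightarrow> (f ^^ j) (X + E 0 c) \<in> T"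
      using open_meets_closure_Wf[OF \<eta>(1) \<eta>' T(2,1) p] by blast
    obtain n w t M \<epsilon> where h: "w1 < w" "w < w2" "linear M" "0 < \<epsilon>" "\<bar>t\<bar> < xX / 4"
      "cu (M (E 0 1)) \<noteq> 0" "\<forall>v. norm v < \<epsilon> \<longrightarrow> (f ^^ n) (X + E 0 w + v) = X + E t 0 + M v"
      using unstable_segment_homoclinic[OF \<eta>(3) w(1-3) quarter] by blast
    have "X + E 0 w \<in> (f ^^ j) -` T" using w(4) h by simp
    then obtain e where e: "0 < e" "ball (X + E 0 w) e \<subseteq> (f ^^ j) -` T"
      using open_vimage_funpow[OF T(2)] by (meson openE)
    have "\<bar>w\<bar> < xX / 4" using h(1,2) w(1,3) \<eta>(2) by linarith
    from homoclinic_imp_periodic[OF h(3,6,4,5) this h(7) e(1)] obtain Q N where Q: "dist Q (X + E 0 w) < e" "0 < N" "(f ^^ N) Q = Q" "Q \<in> closure Wf"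
      by blast
    have "(f ^^ j) Q \<in> T" using Q(1) subsetD[OF e(2), of Q] by (simp add: dist_commute)
    moreover have "(f ^^ N) ((f ^^ j) Q) = (f ^^ j) Q"
    proof -
      have "(f ^^ (N + j)) Q = (f ^^ (j + N)) Q" by (simp only: add.commute)
      then show ?thesis by (simp only: funpow_add comp_apply Q(3))
    qed
    ultimately have "(f ^^ j) Q \<in> ?Per \<inter> T" using closure_Wf_funpow[OF Q(4)] Q(2)
      by (intro IntI CollectI conjI exI[of _ N])
    then show ?thesis by blast
  qed
  from this[of "- closure ?Per"] show "p \<in> closure ?Per" using closure_subset[of ?Per] by blast
qed

text \<open>A piece inside any small ball spreads near both ends of the local unstable segment at
  the same time; points that far apart cannot both stay close to the orbit of
  \<open>P\<close>.\<close>

lemma sensitive: "sensitive_on f (closure Wf)"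
proof -
  obtain \<eta> where \<eta>: "0 < \<eta>" "\<eta> < xX / 4" "\<forall>c. \<bar>c\<bar> \<le> \<eta> \<longrightarrow> X + E 0 c \<in> trap"
    using local_unstable_in_trap by blast
  then have \<eta>': "\<eta> < xX" and quarter: "0 < \<eta> / 4" using xX_pos by auto
  have "\<exists>Q\<in>closure Wf. \<exists>n. dist P Q < \<epsilon> \<and> dist ((f ^^ n) P) ((f ^^ n) Q) > \<eta> / 2"
    if P: "P \<in> closure Wf" and \<epsilon>: "0 < \<epsilon>" for P \<epsilon>
  proof -
    have "P \<in> ball P \<epsilon>" using \<epsilon> by simp
    then obtain j w1 w2 where w: "- \<eta> \<le> w1" "w1 < w2" "w2 \<le> \<eta>"
      "\<forall>c. w1 < c \<and> c < w2 \<longrightarrow> (f ^^ j) (X + E 0 c) \<in> ball P \<epsilon>"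
      using open_meets_closure_Wf[OF \<eta>(1) \<eta>' open_ball _ P] by blast
    obtain n where n: "j \<le> n" "\<forall>v. \<bar>v\<bar> \<le> \<eta> \<longrightarrow> (\<exists>c. w1 < c \<and> c < w2 \<and> dist ((f ^^ n) (X + E 0 c)) (X + E 0 v) < \<eta> / 4)"
      using eventually_conj[OF eventually_ge_at_top[of j] unstable_segment_spreads[OF \<eta>(2,3) w(1-3) quarter]]
        eventually_happens'[OF sequentially_bot] by blast
    obtain c1 c2 where c: "w1 < c1" "c1 < w2" "dist ((f ^^ n) (X + E 0 c1)) (X + E 0 \<eta>) < \<eta> / 4"
      "w1 < c2" "c2 < w2" "dist ((f ^^ n) (X + E 0 c2)) (X + E 0 (- \<eta>)) < \<eta> / 4"
      using n(2)[rule_format, of \<eta>] n(2)[rule_format, of "- \<eta>"] \<eta>(1) by auto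
    have "2 * \<eta> \<le> dist (X + E 0 \<eta>) (X + E 0 (- \<eta>))"
      using dist_fst_le[of "X + E 0 \<eta>" "X + E 0 (- \<eta>)"] \<eta>(1) by (simp add: E_def dist_real_def)
    then have far: "\<eta> < dist ((f ^^ n) (X + E 0 c1)) ((f ^^ n) (X + E 0 c2))"
      using c(3,6) \<eta>(1) dist_triangle[of "X + E 0 \<eta>" "X + E 0 (- \<eta>)" "(f ^^ n) (X + E 0 c1)"]
        dist_triangle[of "(f ^^ n) (X + E 0 c1)" "X + E 0 (- \<eta>)" "(f ^^ n) (X + E 0 c2)"]
        dist_commute[of "X + E 0 \<eta>" "(f ^^ n) (X + E 0 c1)"] by linarith
    have *: "(f ^^ (n - j)) ((f ^^ j) R) = (f ^^ n) R" for R
      using n(1) by (simp flip: funpow_add[THEN fun_cong, unfolded comp_apply])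
    have "\<eta> / 2 < dist ((f ^^ (n - j)) P) ((f ^^ n) (X + E 0 c1)) \<or> \<eta> / 2 < dist ((f ^^ (n - j)) P) ((f ^^ n) (X + E 0 c2))"
      using far dist_triangle3[of "(f ^^ n) (X + E 0 c1)" "(f ^^ n) (X + E 0 c2)" "(f ^^ (n - j)) P"] by linarith
    then obtain c where c: "w1 < c" "c < w2" "\<eta> / 2 < dist ((f ^^ (n - j)) P) ((f ^^ n) (X + E 0 c))"
      using c by blast
    have "(f ^^ j) (X + E 0 c) \<in> Wf" using c w \<eta>' by (intro Wf_funpow local_unstable_subset) auto
    moreover have "dist P ((f ^^ j) (X + E 0 c)) < \<epsilon>" using w(4) c by simp
    ultimately show ?thesis using c(3) closure_subset[of Wf] *[of "X + E 0 c"]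
      by (intro bexI[of _ "(f ^^ j) (X + E 0 c)"] exI[of _ "n - j"]) auto
  qed
  then show ?thesis unfolding sensitive_on_def using \<eta>(1) by (intro exI[of _ "\<eta> / 2"]) auto
qed

lemma devaney: "devaney_chaotic_on f (closure Wf)"
  using transitive periodic_dense sensitive by (simp add: devaney_chaotic_on_def)

end

section \<open>From the parameters to the eigenvalues\<close>

text \<open>The characteristic polynomial is negative at 1, so 1 separates the roots. Stated for a
  general trace and determinant, it also serves the right side with trace
  \<open>- tauR xi\<close>.\<close>

lemma real_roots_around_one:
  fixes t d :: real
  assumes "d + 1 < t" "0 < d"
  defines "u \<equiv> (t + sqrt (t\<^sup>2 - 4 * d)) / 2" and "v \<equiv> (t - sqrt (t\<^sup>2 - 4 * d)) / 2"
  shows "u + v = t" "u * v = d" "1 < u" "0 < v" "v < 1"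
proof -
  have "(d + 1)\<^sup>2 \<le> t\<^sup>2" using assms by (intro power_mono) auto
  moreover have "(d + 1)\<^sup>2 = (d - 1)\<^sup>2 + 4 * d" by (simp add: power2_eq_square algebra_simps)
  ultimately have nn: "0 \<le> t\<^sup>2 - 4 * d" using zero_le_power2[of "d - 1"] by linarith
  show sum: "u + v = t" by (simp add: u_def v_def field_simps)
  have "u * v = (t\<^sup>2 - (sqrt (t\<^sup>2 - 4 * d))\<^sup>2) / 4"
    by (simp add: u_def v_def power2_eq_square algebra_simps)
  then show prod: "u * v = d" using nn by simp
  have "v \<le> u" using nn by (simp add: u_def v_def)
  have "(u - 1) * (1 - v) = u + v - u * v - 1" by (simp add: algebra_simps)
  then have "0 < (u - 1) * (1 - v)" using sum prod assms by simp
  then show "1 < u" "v < 1" using \<open>v \<le> u\<close> by (auto simp: zero_less_mult_iff)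
  then show "0 < v" using prod assms by (smt (verit) zero_less_mult_pos)
qed

theorem theorem2p2:
  fixes xi :: param
  assumes "xi \<in> Phi_BYG" and "J1 xi > 1" and "J2 xi < 1"
  shows "devaney_chaotic_on (bcnf xi) (Lambda xi)"
proof -
  define a s b r where "a = lamLu xi" and "s = lamLs xi" and "b = - lamRu xi" and "r = - lamRs xi"
  have \<Phi>: "tauL xi > deltaL xi + 1" "deltaL xi > 0" "- tauR xi > deltaR xi + 1" "deltaR xi > 0"
    and \<phi>: "phi xi > 0"
    using assms(1) by (auto simp: Phi_BYG_def Phi_def)
  have L: "a + s = tauL xi" "a * s = deltaL xi" "1 < a" "0 < s" "s < 1"
    using real_roots_around_one[OF \<Phi>(1,2)] by (simp_all add: a_def s_def lamLu_def lamLs_def)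
  have be: "b = (- tauR xi + sqrt ((- tauR xi)\<^sup>2 - 4 * deltaR xi)) / 2"
    and re: "r = (- tauR xi - sqrt ((- tauR xi)\<^sup>2 - 4 * deltaR xi)) / 2"
    by (simp_all add: b_def r_def lamRu_def lamRs_def field_simps)
  have R: "b + r = - tauR xi" "b * r = deltaR xi" "1 < b" "0 < r" "r < 1"
    using real_roots_around_one[OF \<Phi>(3,4)] unfolding be re by simp_all
  have tR: "tauR xi = - (b + r)" using R by simp
  interpret bcn a s b r
  proof
    \<comment> \<open>Each maximum in \<open>J2\<close> dominates its first argument.\<close>
    have "s + r \<le> J2 xi" using R by (simp add: J2_def s_def r_def)
    then show "s + r < 1" using assms(3) by simp
    have "J1 xi = a * b\<^sup>2 / (a + b)" using R by (simp add: J1_def a_def b_def)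
    then show "a + b < a * b\<^sup>2" using assms(2) L R by (simp add: less_divide_eq)
    \<comment> \<open>In terms of the eigenvalues, \<open>phi\<close> is the gap in
      \<open>trapping\<close>.\<close>
    have "phi xi = a\<^sup>2 * (1 - s) - (a - 1) * (a * (b + r) + b * r)"
      unfolding phi_def tR L(2)[symmetric] R(2)[symmetric] a_def[symmetric]
      by (simp add: algebra_simps power2_eq_square)
    then show "(a - 1) * (a * (b + r) + b * r) < a\<^sup>2 * (1 - s)" using \<phi> by simp
  qed (use L R in auto)
  have f: "bcnf xi = f"
    by (rule ext) (simp add: bcnf_def f_def AL_def AR_def Let_def L(1,2) R(2) tR)
  have X: "fixX xi = X"
  proof -
    have "deltaR xi + 1 - tauR xi = (1 + b) * (1 + r)" unfolding tR R(2)[symmetric] by (simp add: algebra_simps)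
    then show ?thesis by (simp add: fixX_def X_def xX_def R(2))
  qed
  have "Lambda xi = closure Wf" by (simp add: Lambda_def Wu_def Wf_def f X)
  then show ?thesis using devaney f by simp
qed

end
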